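(* Let $q \geq 5$ be an odd prime power, and let $G$ be a finite group with a minimal normal subgroup $N = \mathrm{PSL}_2(q)\times\cdots\times\mathrm{PSL}_2(q)$, a direct product of $k$ copies of $\mathrm{PSL}_2(q)$, such that $|G/N| \geq q^k$. Write $|G| = b(G)(b(G)+e)$. Then $e > \sqrt{b(G)}+1$, and in particular $|G| < e^4-e^3$.
   Context: $b(G)$ denotes the largest degree of a complex irreducible character of $G$. *)

theory Defs
  imports "HOL-Algebra.Algebra" "Jordan_Normal_Form.Matrix"
begin

text \<open>2x2 matrices are represented as 4-tuples (a,b,c,d) = [[a,b],[c,d]].\<close>

definition SL2 :: "('f, 'm) ring_scheme \<Rightarrow> ('f \<times> 'f \<times> 'f \<times> 'f) monoid" where
  "SL2 F = \<lparr> carrier = {(a,b,c,d). a \<in> carrier F \<and> b \<in> carrier F \<and> c \<in> carrier F \<and> d \<in> carrier F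
                          \<and> a \<otimes>\<^bsub>F\<^esub> d \<ominus>\<^bsub>F\<^esub> b \<otimes>\<^bsub>F\<^esub> c = \<one>\<^bsub>F\<^esub>},
             monoid.mult = (\<lambda>(a,b,c,d) (e,f,g,h).
                 (a \<otimes>\<^bsub>F\<^esub> e \<oplus>\<^bsub>F\<^esub> b \<otimes>\<^bsub>F\<^esub> g, a \<otimes>\<^bsub>F\<^esub> f \<oplus>\<^bsub>F\<^esub> b \<otimes>\<^bsub>F\<^esub> h,
                  c \<otimes>\<^bsub>F\<^esub> e \<oplus>\<^bsub>F\<^esub> d \<otimes>\<^bsub>F\<^esub> g, c \<otimes>\<^bsub>F\<^esub> f \<oplus>\<^bsub>F\<^esub> d \<otimes>\<^bsub>F\<^esub> h)),
             one = (\<one>\<^bsub>F\<^esub>, \<zero>\<^bsub>F\<^esub>, \<zero>\<^bsub>F\<^esub>, \<one>\<^bsub>F\<^esub>) \<rparr>"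

definition PSL2 :: "('f, 'm) ring_scheme \<Rightarrow> ('f \<times> 'f \<times> 'f \<times> 'f) set monoid" where
  "PSL2 F = SL2 F Mod {(\<one>\<^bsub>F\<^esub>, \<zero>\<^bsub>F\<^esub>, \<zero>\<^bsub>F\<^esub>, \<one>\<^bsub>F\<^esub>),
                       (\<ominus>\<^bsub>F\<^esub> \<one>\<^bsub>F\<^esub>, \<zero>\<^bsub>F\<^esub>, \<zero>\<^bsub>F\<^esub>, \<ominus>\<^bsub>F\<^esub> \<one>\<^bsub>F\<^esub>)}"

definition minimal_normal :: "'a set \<Rightarrow> ('a, 'b) monoid_scheme \<Rightarrow> bool" where
  "minimal_normal N G \<longleftrightarrow> N \<lhd> G \<and> N \<noteq> {\<one>\<^bsub>G\<^esub>} \<and>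
     (\<forall>M. M \<lhd> G \<and> M \<subseteq> N \<longrightarrow> M = {\<one>\<^bsub>G\<^esub>} \<or> M = N)"

definition is_rep :: "('a, 'b) monoid_scheme \<Rightarrow> nat \<Rightarrow> ('a \<Rightarrow> complex mat) \<Rightarrow> bool" where
  "is_rep G n \<rho> \<longleftrightarrow> (\<forall>g \<in> carrier G. \<rho> g \<in> carrier_mat n n) \<and>
     \<rho> \<one>\<^bsub>G\<^esub> = 1\<^sub>m n \<and>
     (\<forall>g \<in> carrier G. \<forall>h \<in> carrier G. \<rho> (g \<otimes>\<^bsub>G\<^esub> h) = \<rho> g * \<rho> h)"

definition is_subspace :: "nat \<Rightarrow> complex vec set \<Rightarrow> bool" where
  "is_subspace n W \<longleftrightarrow> W \<subseteq> carrier_vec n \<and> 0\<^sub>v n \<in> W \<and>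
     (\<forall>v \<in> W. \<forall>w \<in> W. v + w \<in> W) \<and> (\<forall>c. \<forall>v \<in> W. c \<cdot>\<^sub>v v \<in> W)"

definition is_irrep :: "('a, 'b) monoid_scheme \<Rightarrow> nat \<Rightarrow> ('a \<Rightarrow> complex mat) \<Rightarrow> bool" where
  "is_irrep G n \<rho> \<longleftrightarrow> is_rep G n \<rho> \<and> n > 0 \<and>
     (\<forall>W. is_subspace n W \<and> (\<forall>g \<in> carrier G. \<forall>w \<in> W. \<rho> g *\<^sub>v w \<in> W)
          \<longrightarrow> W = {0\<^sub>v n} \<or> W = carrier_vec n)"

text \<open>b(G): the largest degree of a complex irreducible character of G,
  i.e. the largest dimension of an irreducible complex representation.\<close>
definition b :: "('a, 'b) monoid_scheme \<Rightarrow> nat" where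
  "b G = Max {n. \<exists>\<rho>. is_irrep G n \<rho>}"

end

theory Submission
  imports Defs "Jordan_Normal_Form.Spectral_Radius" "HOL-Analysis.Convex"
begin

hide_const (open) Polynomial.order

text \<open>
  Every irreducible degree d of G satisfies 2 d^2 \<le> |G|, from which both inequalities are
  elementary. Let P be the set of all x in N with x^q = 1. It is invariant under conjugation in G,
  so by Schur's lemma the sum of P acts in an irreducible representation \<rho> as a scalar \<mu>.
  On functions on PSL2(q), convolution with the elements satisfying x^q = 1 has only the
  eigenvalues q^2, 1, q and -q (on the trivial, Steinberg, principal series and discrete series
  parts); this splits the point mass at the identity into four eigenfunctions, each of squared
  norm at most 1/2. Tensoring k of them and keeping the products with eigenvalue \<mu> gives a
  function h on N with \<rho>(h) = 1. The squared norm of h is the probability that a product of k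
  independent nonzero random eigenvalues equals \<mu>, hence at most 1/2 by conditioning on all but
  one factor. Pairing h with the character \<chi> and using \<Sum> |\<chi>|^2 = |G|, Cauchy-Schwarz yields
  d^2 \<le> |G|/2.
\<close>

section \<open>Schur orthogonality\<close>

text \<open>G may permute the factors of N and induce outer automorphisms on each of them, which can
  fuse the two classes of nontrivial unipotent elements of PSL2(q). The equation x^q = 1 is
  preserved by all of this, so the whole solution set is used rather than one class. The restriction
  of \<rho> to N is not controlled, so \<mu> stays unknown and the mass of every possible product of
  eigenvalues has to be bounded. For this, 0 must not be an eigenvalue, and no single eigenvalue may
  carry more than half of the mass. On one factor of order n, the masses of q^2 and 1 are 1/n and
  2q/(q^2 - 1), and the rest is split almost evenly between q and -q; q \<ge> 5 brings 2q/(q^2 - 1)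
  below 1/2. The eigenfunctions are built from counts of vectors in the natural module of SL2(q).
  The factor 2 in 2 d^2 \<le> |G| = d(d + e) is what gives e \<ge> d; the bound d^2 \<le> |G| would
  only give e \<ge> 0.\<close>

definition mat_trace :: "'a::comm_ring_1 mat \<Rightarrow> 'a" where
  "mat_trace A = (\<Sum>i<dim_row A. A $$ (i, i))"

lemma mat_mult_index_sum:
  assumes "A \<in> carrier_mat n m" "B \<in> carrier_mat m l" "i < n" "j < l"
  shows "(A * B) $$ (i, j) = (\<Sum>k<m. A $$ (i, k) * B $$ (k, j))"
  using assms by (auto simp: scalar_prod_def atLeast0LessThan)

lemma mat_trace_mult_comm:
  assumes "A \<in> carrier_mat n m" "B \<in> carrier_mat m n"
  shows "mat_trace (A * B) = mat_trace (B * A)"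
proof -
  have "mat_trace (A * B) = (\<Sum>i<n. \<Sum>k<m. A $$ (i, k) * B $$ (k, i))"
    using assms mat_mult_index_sum[OF assms] by (simp add: mat_trace_def del: index_mult_mat(1))
  also have "\<dots> = (\<Sum>k<m. \<Sum>i<n. B $$ (k, i) * A $$ (i, k))"
    by (subst sum.swap) (simp add: mult.commute)
  also have "\<dots> = mat_trace (B * A)"
    using assms mat_mult_index_sum[OF assms(2,1)] by (simp add: mat_trace_def del: index_mult_mat(1))
  finally show ?thesis .
qed

lemma mat_trace_similar:
  assumes "similar_mat A B"
  shows "mat_trace A = mat_trace B"
proof -
  from similar_matD[OF assms] obtain n P Q where
    c: "{A, B, P, Q} \<subseteq> carrier_mat n n" and QP: "Q * P = 1\<^sub>m n" and A: "A = P * B * Q"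
    by auto
  have "mat_trace A = mat_trace (Q * (P * B))"
    unfolding A using c by (intro mat_trace_mult_comm[of _ n n]) auto
  also have "Q * (P * B) = (Q * P) * B"
    using c by (intro assoc_mult_mat[symmetric]) auto
  also have "\<dots> = B" unfolding QP using c by (intro left_mult_one_mat) auto
  finally show ?thesis .
qed

lemma upper_triangular_mult:
  fixes A B :: "'a::comm_ring_1 mat"
  assumes "A \<in> carrier_mat n n" "B \<in> carrier_mat n n" "upper_triangular A" "upper_triangular B"
  shows "upper_triangular (A * B)" "i < n \<Longrightarrow> (A * B) $$ (i, i) = A $$ (i, i) * B $$ (i, i)"
proof -
  have z: "A $$ (i, k) * B $$ (k, j) = 0" if "i < n" "k < n" "j \<le> i" "k \<noteq> i \<or> j < i" for i j k
  proof (cases "k < i")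
    case True
    then show ?thesis using assms(1,3) that by (auto simp: upper_triangular_def)
  next
    case False
    with that have "j < k" by auto
    then show ?thesis using assms(2,4) that by (auto simp: upper_triangular_def)
  qed
  show "upper_triangular (A * B)"
    unfolding upper_triangular_def
  proof (intro allI impI)
    fix i j assume "i < dim_row (A * B)" "j < i"
    then have ij: "i < n" "j < i" "j < n" using assms by auto
    show "(A * B) $$ (i, j) = 0"
      unfolding mat_mult_index_sum[OF assms(1,2) ij(1,3)]
      using z ij by (intro sum.neutral) auto
  qed
  assume i: "i < n"
  have "(A * B) $$ (i, i) = (\<Sum>k<n. if k = i then A $$ (i, i) * B $$ (i, i) else 0)"
    unfolding mat_mult_index_sum[OF assms(1,2) i i]
    using z[OF i] by (intro sum.cong) auto
  then show "(A * B) $$ (i, i) = A $$ (i, i) * B $$ (i, i)" using i by simp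
qed

lemma upper_triangular_pow:
  fixes A :: "'a::comm_ring_1 mat"
  assumes "A \<in> carrier_mat n n" "upper_triangular A"
  shows "upper_triangular (A ^\<^sub>m k) \<and> (\<forall>i<n. (A ^\<^sub>m k) $$ (i, i) = A $$ (i, i) ^ k)"
proof (induction k)
  case 0
  show ?case using assms by (auto simp: upper_triangular_def)
next
  case (Suc k)
  have c: "A ^\<^sub>m k \<in> carrier_mat n n" using assms by simp
  show ?case
    using upper_triangular_mult[OF c assms(1) _ assms(2)] Suc by (simp add: mult.commute)
qed

text \<open>After triangularisation the diagonal entries are k-th roots of unity, and for those the
  power k - 1 is the inverse, hence the conjugate. This yields \<chi>(g^-1) = cnj \<chi>(g) for a
  representation that is not assumed unitary.\<close>

lemma mat_trace_finite_order:
  fixes A :: "complex mat"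
  assumes A: "A \<in> carrier_mat n n" and k: "A ^\<^sub>m k = 1\<^sub>m n" "k > 0"
  shows "mat_trace (A ^\<^sub>m (k - 1)) = cnj (mat_trace A)"
proof -
  obtain es where "char_poly A = (\<Prod>a\<leftarrow>es. [:- a, 1:])"
    using char_poly_factorized[OF A] by auto
  from schur_decomposition_exists[OF A this] obtain B where
    B: "B \<in> carrier_mat n n" "upper_triangular B" and sim: "similar_mat A B" by auto
  have simp': "similar_mat (A ^\<^sub>m j) (B ^\<^sub>m j)" for j
    using sim similar_mat_wit_pow unfolding similar_mat_def by blast
  \<comment> \<open>Only the identity is similar to the identity, so the triangular matrix
    \<open>B\<close> itself satisfies B^k = 1.\<close>
  have "similar_mat (B ^\<^sub>m k) (1\<^sub>m n)"
    using similar_mat_sym[OF simp'[of k]] k by simp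
  from similar_matD[OF this] obtain m P Q where c: "{B ^\<^sub>m k, 1\<^sub>m n, P, Q} \<subseteq> carrier_mat m m"
    and PQ: "P * Q = 1\<^sub>m m" and Bk': "B ^\<^sub>m k = P * 1\<^sub>m n * Q" by blast
  have "m = n" using c by auto
  have "P * 1\<^sub>m n = P" using c \<open>m = n\<close> by (intro right_mult_one_mat) auto
  with Bk' PQ have Bk: "B ^\<^sub>m k = 1\<^sub>m n" by (simp add: \<open>m = n\<close>)
  have "(B ^\<^sub>m (k - 1)) $$ (i, i) = cnj (B $$ (i, i))" if i: "i < n" for i
  proof -
    have "B $$ (i, i) ^ k = 1"
      using upper_triangular_pow[OF B, of k] Bk i by auto
    then have 1: "B $$ (i, i) * B $$ (i, i) ^ (k - 1) = 1" and nz: "B $$ (i, i) \<noteq> 0"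
      using k(2) by (cases k; auto)+
    have "cmod (B $$ (i, i)) ^ k = 1"
      using arg_cong[OF \<open>B $$ (i, i) ^ k = 1\<close>, of cmod] by (simp add: norm_power)
    then have "cmod (B $$ (i, i)) = 1"
      using k(2) power_eq_imp_eq_base[of "cmod (B $$ (i, i))" k 1] by simp
    then have "B $$ (i, i) * cnj (B $$ (i, i)) = 1"
      by (simp add: complex_norm_square[symmetric])
    with 1 have "B $$ (i, i) * B $$ (i, i) ^ (k - 1) = B $$ (i, i) * cnj (B $$ (i, i))" by simp
    with nz have "B $$ (i, i) ^ (k - 1) = cnj (B $$ (i, i))"
      using mult_left_cancel by blast
    then show ?thesis using upper_triangular_pow[OF B, of "k - 1"] i by auto
  qed
  then have "mat_trace (B ^\<^sub>m (k - 1)) = cnj (mat_trace B)"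
    using B by (simp add: mat_trace_def)
  then show ?thesis using mat_trace_similar[OF simp'] mat_trace_similar[OF sim] by simp
qed

text \<open>An eigenspace of \<open>M\<close> is nonzero and, as \<open>M\<close> commutes with the
  representation, invariant; irreducibility makes it the whole space.\<close>

lemma schur_scalar:
  assumes irr: "is_irrep G n \<rho>" and M: "M \<in> carrier_mat n n"
    and comm: "\<And>g. g \<in> carrier G \<Longrightarrow> \<rho> g * M = M * \<rho> g"
  shows "\<exists>c. M = c \<cdot>\<^sub>m 1\<^sub>m n"
proof -
  have n: "n > 0" and \<rho>: "\<And>g. g \<in> carrier G \<Longrightarrow> \<rho> g \<in> carrier_mat n n"
    using irr by (auto simp: is_irrep_def is_rep_def)
  from spectrum_non_empty[OF M n] obtain c v where
    v: "v \<in> carrier_vec n" "v \<noteq> 0\<^sub>v n" "M *\<^sub>v v = c \<cdot>\<^sub>v v"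
    using M by (auto simp: spectrum_def eigenvalue_def eigenvector_def)
  define W where "W = {w \<in> carrier_vec n. M *\<^sub>v w = c \<cdot>\<^sub>v w}"
  have "is_subspace n W"
    unfolding is_subspace_def W_def using M
    by (auto simp: mult_add_distrib_mat_vec smult_add_distrib_vec mult_mat_vec smult_smult_assoc mult.commute)
  moreover have "\<rho> g *\<^sub>v w \<in> W" if "g \<in> carrier G" "w \<in> W" for g w
  proof -
    have w: "w \<in> carrier_vec n" "M *\<^sub>v w = c \<cdot>\<^sub>v w" using that by (auto simp: W_def)
    have "M *\<^sub>v (\<rho> g *\<^sub>v w) = (\<rho> g * M) *\<^sub>v w"
      using comm[OF that(1)] assoc_mult_mat_vec[OF M \<rho>[OF that(1)] w(1)] by simp
    also have "\<dots> = c \<cdot>\<^sub>v (\<rho> g *\<^sub>v w)"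
      using assoc_mult_mat_vec[OF \<rho>[OF that(1)] M w(1)] w mult_mat_vec[OF \<rho>[OF that(1)] w(1)] by simp
    finally show ?thesis using \<rho>[OF that(1)] w by (simp add: W_def)
  qed
  ultimately have "W = {0\<^sub>v n} \<or> W = carrier_vec n"
    using irr by (simp add: is_irrep_def)
  moreover have "v \<in> W" using v by (simp add: W_def)
  ultimately have W: "W = carrier_vec n" using v(2) by auto
  have "M = c \<cdot>\<^sub>m 1\<^sub>m n"
  proof (rule eq_matI)
    fix i j assume ij: "i < dim_row (c \<cdot>\<^sub>m 1\<^sub>m n)" "j < dim_col (c \<cdot>\<^sub>m 1\<^sub>m n)"
    then have "unit_vec n j \<in> W" unfolding W by simp
    then have "(M *\<^sub>v unit_vec n j) $ i = (c \<cdot>\<^sub>v unit_vec n j) $ i" by (simp add: W_def)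
    then show "M $$ (i, j) = (c \<cdot>\<^sub>m 1\<^sub>m n) $$ (i, j)" using M ij by (simp add: scalar_prod_right_unit)
  qed (use M in auto)
  then show ?thesis ..
qed

section \<open>Orthogonality of matrix entries and the norm of an irreducible character\<close>

lemma rep_mult_index:
  assumes "is_rep G n \<rho>" "g \<in> carrier G" "h \<in> carrier G" "i < n" "j < n"
  shows "\<rho> (g \<otimes>\<^bsub>G\<^esub> h) $$ (i, j) = (\<Sum>m<n. \<rho> g $$ (i, m) * \<rho> h $$ (m, j))"
  using assms mat_mult_index_sum[of "\<rho> g" n n "\<rho> h" n i j] by (simp add: is_rep_def)

lemma (in group) sum_translate:
  assumes "a \<in> carrier G"
  shows "(\<Sum>x\<in>carrier G. f (a \<otimes> x)) = (\<Sum>x\<in>carrier G. f x)"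
proof -
  have "bij_betw (\<lambda>x. a \<otimes> x) (carrier G) (carrier G)"
    using assms
    by (intro bij_betwI[where g = "\<lambda>x. inv a \<otimes> x"]) (auto simp: inv_solve_left' m_assoc[symmetric])
  then show ?thesis by (rule sum.reindex_bij_betw)
qed

lemma (in group) schur_orthogonality:
  assumes irr: "is_irrep G n \<rho>" and j: "j < n" "k < n" "i < n" "l < n"
  shows "(\<Sum>g\<in>carrier G. \<rho> g $$ (i, j) * \<rho> (inv g) $$ (k, l)) =
    (if i = l \<and> j = k then of_nat (order G) / of_nat n else 0)"
proof -
  have rep: "is_rep G n \<rho>" and n: "n > 0" using irr by (auto simp: is_irrep_def)
  note \<rho>m = rep_mult_index[OF rep]
  have \<rho>c: "\<rho> g \<in> carrier_mat n n" if "g \<in> carrier G" for g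
    using rep that by (simp add: is_rep_def)
  \<comment> \<open>With j and k fixed, these sums are the entries of the average \<Sum> \<rho>(g)
    E_jk \<rho>(g^-1), where E_jk is a matrix unit. Such an average commutes with the
    representation.\<close>
  define M where "M = mat n n (\<lambda>(i, l). \<Sum>g\<in>carrier G. \<rho> g $$ (i, j) * \<rho> (inv g) $$ (k, l))"
  have Mc: "M \<in> carrier_mat n n" by (simp add: M_def)
  have "\<rho> h * M = M * \<rho> h" if h: "h \<in> carrier G" for h
  proof (rule eq_matI)
    fix i l assume "i < dim_row (M * \<rho> h)" "l < dim_col (M * \<rho> h)"
    then have il: "i < n" "l < n" using Mc \<rho>c[OF h] by auto
    have "(\<rho> h * M) $$ (i, l) = (\<Sum>m<n. \<Sum>g\<in>carrier G. \<rho> h $$ (i, m) * \<rho> g $$ (m, j) * \<rho> (inv g) $$ (k, l))"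
      using il mat_mult_index_sum[OF \<rho>c[OF h] Mc il]
      by (simp add: M_def sum_distrib_left mult.assoc del: index_mult_mat(1))
    also have "\<dots> = (\<Sum>g\<in>carrier G. (\<Sum>m<n. \<rho> h $$ (i, m) * \<rho> g $$ (m, j)) * \<rho> (inv g) $$ (k, l))"
      by (subst sum.swap) (simp add: sum_distrib_right)
    also have "\<dots> = (\<Sum>g\<in>carrier G. \<rho> (h \<otimes> g) $$ (i, j) * \<rho> (inv (h \<otimes> g) \<otimes> h) $$ (k, l))"
      using il j h by (intro sum.cong) (simp_all add: \<rho>m inv_mult_group m_assoc)
    also have "\<dots> = (\<Sum>g\<in>carrier G. \<rho> g $$ (i, j) * \<rho> (inv g \<otimes> h) $$ (k, l))"
      by (rule sum_translate[OF h])
    also have "\<dots> = (\<Sum>g\<in>carrier G. \<Sum>m<n. \<rho> g $$ (i, j) * \<rho> (inv g) $$ (k, m) * \<rho> h $$ (m, l))"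
      using il j h by (intro sum.cong) (simp_all add: \<rho>m sum_distrib_left mult.assoc)
    also have "\<dots> = (M * \<rho> h) $$ (i, l)"
      using il mat_mult_index_sum[OF Mc \<rho>c[OF h] il]
      by (subst sum.swap) (simp add: M_def sum_distrib_right del: index_mult_mat(1))
    finally show "(\<rho> h * M) $$ (i, l) = (M * \<rho> h) $$ (i, l)" .
  qed (use Mc \<rho>c[OF h] in auto)
  from schur_scalar[OF irr Mc this] obtain c where c: "M = c \<cdot>\<^sub>m 1\<^sub>m n" by auto
  \<comment> \<open>The trace determines the scalar: every summand of the average has the trace of
    E_jk.\<close>
  have "of_nat n * c = (\<Sum>i<n. M $$ (i, i))" by (simp add: c)
  also have "\<dots> = (\<Sum>g\<in>carrier G. \<Sum>i<n. \<rho> (inv g) $$ (k, i) * \<rho> g $$ (i, j))"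
    by (subst sum.swap) (simp add: M_def mult.commute)
  also have "\<dots> = (\<Sum>g\<in>carrier G. \<rho> \<one> $$ (k, j))"
    using j by (intro sum.cong) (simp_all flip: \<rho>m)
  also have "\<dots> = (if j = k then of_nat (order G) else 0)"
    using rep j by (auto simp: is_rep_def Coset.order_def)
  finally have "c = (if j = k then of_nat (order G) / of_nat n else 0)"
    using n by (auto simp: field_simps split: if_splits)
  moreover have "(\<Sum>g\<in>carrier G. \<rho> g $$ (i, j) * \<rho> (inv g) $$ (k, l)) = M $$ (i, l)"
    using j by (simp add: M_def)
  ultimately show ?thesis using j by (simp add: c)
qed

lemma (in group) mat_trace_rep_inv:
  assumes fin: "finite (carrier G)" and rep: "is_rep G n \<rho>" and g: "g \<in> carrier G"
  shows "mat_trace (\<rho> (inv g)) = cnj (mat_trace (\<rho> g))"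
proof -
  have c: "\<rho> g \<in> carrier_mat n n" using rep g by (simp add: is_rep_def)
  have pow: "\<rho> (g [^] k) = \<rho> g ^\<^sub>m k" for k :: nat
    by (induction k) (use rep g in \<open>auto simp: is_rep_def\<close>)
  have o: "order G > 0" using fin by (simp add: order_gt_0_iff_finite)
  have "\<rho> g ^\<^sub>m order G = 1\<^sub>m n"
    using pow[of "order G"] pow_order_eq_1[OF g] rep by (simp add: is_rep_def)
  from mat_trace_finite_order[OF c this o]
  have "mat_trace (\<rho> (g [^] (order G - 1))) = cnj (mat_trace (\<rho> g))" by (simp add: pow)
  moreover have "g [^] (order G - 1) \<otimes> g = \<one>"
    using pow_order_eq_1[OF g] o by (metis Suc_diff_1 nat_pow_Suc)
  then have "g [^] (order G - 1) = inv g"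
    using g by (metis inv_equality nat_pow_closed)
  ultimately show ?thesis by simp
qed

lemma (in group) sum_norm_character:
  assumes fin: "finite (carrier G)" and irr: "is_irrep G n \<rho>"
  shows "(\<Sum>g\<in>carrier G. (cmod (mat_trace (\<rho> g)))\<^sup>2) = real (order G)"
proof -
  have rep: "is_rep G n \<rho>" and n: "n > 0" using irr by (auto simp: is_irrep_def)
  have tr: "mat_trace (\<rho> g) = (\<Sum>i<n. \<rho> g $$ (i, i))" if "g \<in> carrier G" for g
    using rep that by (auto simp: is_rep_def mat_trace_def)
  have "complex_of_real (\<Sum>g\<in>carrier G. (cmod (mat_trace (\<rho> g)))\<^sup>2)
      = (\<Sum>g\<in>carrier G. mat_trace (\<rho> g) * mat_trace (\<rho> (inv g)))"
    by (simp add: complex_norm_square mat_trace_rep_inv[OF fin rep] flip: of_real_power)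
  also have "\<dots> = (\<Sum>g\<in>carrier G. \<Sum>i<n. \<Sum>k<n. \<rho> g $$ (i, i) * \<rho> (inv g) $$ (k, k))"
    by (intro sum.cong) (simp_all add: tr sum_product)
  also have "\<dots> = (\<Sum>i<n. \<Sum>k<n. \<Sum>g\<in>carrier G. \<rho> g $$ (i, i) * \<rho> (inv g) $$ (k, k))"
    by (subst sum.swap, intro sum.cong refl, subst sum.swap, simp)
  also have "\<dots> = (\<Sum>i<n. \<Sum>k<n. if k = i then of_nat (order G) / of_nat n else 0)"
    by (intro sum.cong refl, subst schur_orthogonality[OF irr]) auto
  also have "\<dots> = of_nat (order G)" using n by simp
  finally show ?thesis by (metis of_real_eq_iff of_real_of_nat_eq)
qed

text \<open>Cauchy-Schwarz for \<open>h\<close> and the character. Injectivity of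
  \<open>\<phi>\<close> makes the sum of |\<chi>|^2 over \<open>T\<close> a part of the sum over the
  group, which equals its order. Any element of the group algebra whose trace is the degree may
  serve as \<open>h\<close>; the smaller its norm, the better the bound.\<close>

lemma (in group) degree_bound_of_trace:
  fixes h :: "'x \<Rightarrow> real"
  assumes fin: "finite (carrier G)" and irr: "is_irrep G n \<rho>"
    and \<phi>: "inj_on \<phi> T" "\<phi> ` T \<subseteq> carrier G"
    and h: "(\<Sum>x\<in>T. of_real (h x) * mat_trace (\<rho> (\<phi> x))) = of_nat n"
  shows "(real n)\<^sup>2 \<le> real (order G) * (\<Sum>x\<in>T. (h x)\<^sup>2)"
proof -
  let ?t = "\<lambda>x. cmod (mat_trace (\<rho> x))"
  have "real n = cmod (\<Sum>x\<in>T. of_real (h x) * mat_trace (\<rho> (\<phi> x)))" using h by simp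
  also have "\<dots> \<le> (\<Sum>x\<in>T. \<bar>h x\<bar> * ?t (\<phi> x))"
    by (rule sum_norm_le) (simp add: norm_mult)
  finally have "(real n)\<^sup>2 \<le> (\<Sum>x\<in>T. \<bar>h x\<bar> * ?t (\<phi> x))\<^sup>2" by (rule power_mono) simp
  also have "\<dots> \<le> (\<Sum>x\<in>T. \<bar>h x\<bar>\<^sup>2) * (\<Sum>x\<in>T. (?t (\<phi> x))\<^sup>2)" by (rule Cauchy_Schwarz_ineq_sum)
  also have "(\<Sum>x\<in>T. (?t (\<phi> x))\<^sup>2) = (\<Sum>y\<in>\<phi> ` T. (?t y)\<^sup>2)"
    by (simp add: sum.reindex[OF \<phi>(1)])
  also have "(\<Sum>x\<in>T. \<bar>h x\<bar>\<^sup>2) * \<dots> \<le> (\<Sum>x\<in>T. \<bar>h x\<bar>\<^sup>2) * (\<Sum>x\<in>carrier G. (?t x)\<^sup>2)"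
    using fin \<phi>(2) by (intro mult_left_mono sum_mono2 sum_nonneg) auto
  finally show ?thesis by (simp add: sum_norm_character[OF fin irr] mult.commute)
qed

section \<open>Degree bounds from convolution eigenfunctions\<close>

text \<open>Read \<open>w\<close> as the law of independent random factors: the sum is the
  probability that their product is \<open>\<mu>\<close>. Zero is excluded from \<open>A\<close>
  because a zero factor would make the product independent of the remaining one.\<close>

lemma sum_PiE_prod_eq_le:
  fixes w :: "'a::field \<Rightarrow> real"
  assumes "finite I" "I \<noteq> {}" "finite A" "0 \<notin> A"
    and w: "\<And>a. a \<in> A \<Longrightarrow> 0 \<le> w a" "\<And>a. a \<in> A \<Longrightarrow> w a \<le> c" "sum w A = 1"
  shows "(\<Sum>\<tau> | \<tau> \<in> I \<rightarrow>\<^sub>E A \<and> (\<Prod>i\<in>I. \<tau> i) = \<mu>. \<Prod>i\<in>I. w (\<tau> i)) \<le> c"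
proof -
  from \<open>I \<noteq> {}\<close> obtain j where "j \<in> I" by auto
  then obtain J where I: "I = insert j J" and j: "j \<notin> J" by (rule Set.set_insert)
  have J: "finite J" using assms(1) unfolding I by simp
  have A: "A \<noteq> {}" using w(3) by (metis sum.empty zero_neq_one)
  then obtain a where "a \<in> A" by auto
  with w(1,2) have c: "0 \<le> c" by (meson order_trans)
  let ?g = "\<lambda>\<tau>. if (\<Prod>i\<in>I. \<tau> i) = \<mu> then \<Prod>i\<in>I. w (\<tau> i) else 0"
  let ?v = "\<lambda>\<sigma>. \<Prod>i\<in>J. w (\<sigma> i)"
  have "(\<Sum>\<tau> | \<tau> \<in> I \<rightarrow>\<^sub>E A \<and> (\<Prod>i\<in>I. \<tau> i) = \<mu>. \<Prod>i\<in>I. w (\<tau> i)) = (\<Sum>\<tau>\<in>I \<rightarrow>\<^sub>E A. ?g \<tau>)"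
    using assms(1,3) finite_PiE[of I "\<lambda>_. A"] by (subst sum.If_cases) (auto simp: Int_def)
  also have "\<dots> = (\<Sum>(a, \<sigma>)\<in>A \<times> (J \<rightarrow>\<^sub>E A). ?g (\<sigma>(j := a)))"
    unfolding I PiE_insert_eq
    by (subst sum.reindex) (use j inj_combinator[of j J] in \<open>auto simp: case_prod_unfold\<close>)
  also have "\<dots> = (\<Sum>\<sigma>\<in>J \<rightarrow>\<^sub>E A. \<Sum>a\<in>A. ?g (\<sigma>(j := a)))"
    by (subst sum.cartesian_product[symmetric]) (rule sum.swap)
  \<comment> \<open>once the coordinates in J are chosen, at most one value of the remaining one gives product \<mu>\<close>
  also have "\<dots> \<le> (\<Sum>\<sigma>\<in>J \<rightarrow>\<^sub>E A. c * ?v \<sigma>)"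
  proof (rule sum_mono)
    fix \<sigma> assume \<sigma>: "\<sigma> \<in> J \<rightarrow>\<^sub>E A"
    have upd: "(\<Prod>i\<in>J. (\<sigma>(j := a)) i) = (\<Prod>i\<in>J. \<sigma> i)" "(\<Prod>i\<in>J. w ((\<sigma>(j := a)) i)) = ?v \<sigma>" for a
      using j by (auto intro!: prod.cong)
    have v0: "0 \<le> ?v \<sigma>" using \<sigma> w by (intro prod_nonneg) auto
    have nz: "(\<Prod>i\<in>J. \<sigma> i) \<noteq> 0" using \<sigma> assms(4) J by (metis PiE_E prod_zero_iff)
    have "(\<Sum>a\<in>A. ?g (\<sigma>(j := a))) = (\<Sum>a\<in>A. if a = \<mu> / (\<Prod>i\<in>J. \<sigma> i) then w a * ?v \<sigma> else 0)"
      using j J nz by (intro sum.cong refl) (auto simp: I upd field_simps simp del: fun_upd_apply, auto simp: field_simps)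
    also have "\<dots> \<le> c * ?v \<sigma>"
      using assms(3) w v0 c by (simp add: mult_right_mono)
    finally show "(\<Sum>a\<in>A. ?g (\<sigma>(j := a))) \<le> c * ?v \<sigma>" .
  qed
  also have "\<dots> = c * (\<Prod>i\<in>J. sum w A)"
    by (subst prod_sum_PiE) (use J assms(3) in \<open>auto simp: sum_distrib_left\<close>)
  finally show ?thesis using w(3) by simp
qed

text \<open>The functions \<open>\<epsilon> a\<close> split the point mass at the identity into
  eigenfunctions of convolution with \<open>P\<close>. Their orthogonality and norms are
  consequences: they follow from the symmetry of \<open>P\<close> and from indexing the functions by
  their eigenvalues, so that different functions have different eigenvalues.\<close>

locale spectral_family = group S for S (structure) +
  fixes P :: "'a set" and A :: "real set" and \<epsilon> :: "real \<Rightarrow> 'a \<Rightarrow> real"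
  assumes finite_carrier: "finite (carrier S)"
    and P_carrier: "P \<subseteq> carrier S"
    and P_inv: "z \<in> P \<Longrightarrow> inv z \<in> P"
    and finite_A: "finite A" and zero_notin_A: "0 \<notin> A"
    and sum_eq: "x \<in> carrier S \<Longrightarrow> (\<Sum>a\<in>A. \<epsilon> a x) = (if x = \<one> then 1 else 0)"
    and eigen: "\<lbrakk>a \<in> A; y \<in> carrier S\<rbrakk> \<Longrightarrow> (\<Sum>z\<in>P. \<epsilon> a (inv z \<otimes> y)) = a * \<epsilon> a y"
begin

definition weight :: "real \<Rightarrow> real" where
  "weight a = (\<Sum>x\<in>carrier S. (\<epsilon> a x)\<^sup>2)"

lemma sum_P_inv: "(\<Sum>z\<in>P. f (inv z)) = (\<Sum>z\<in>P. f z)"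
proof -
  have "bij_betw (\<lambda>z. inv z) P P"
    using P_carrier by (intro bij_betwI[where g = "\<lambda>z. inv z"]) (auto simp: P_inv)
  then show ?thesis by (rule sum.reindex_bij_betw)
qed

text \<open>Substituting z y for y moves the translation to the other factor with z replaced by its
  inverse, and \<open>P\<close> is closed under inverses.\<close>

lemma sum_P_self_adjoint:
  "(\<Sum>y\<in>carrier S. (\<Sum>z\<in>P. f (inv z \<otimes> y)) * g y) = (\<Sum>y\<in>carrier S. f y * (\<Sum>z\<in>P. g (inv z \<otimes> y)))"
  for f g :: "'a \<Rightarrow> real"
proof -
  have "(\<Sum>y\<in>carrier S. (\<Sum>z\<in>P. f (inv z \<otimes> y)) * g y) = (\<Sum>z\<in>P. \<Sum>y\<in>carrier S. f (inv z \<otimes> y) * g y)"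
    by (subst sum.swap) (simp add: sum_distrib_right)
  also have "\<dots> = (\<Sum>z\<in>P. \<Sum>y\<in>carrier S. f (inv z \<otimes> y) * g (z \<otimes> (inv z \<otimes> y)))"
    using P_carrier by (intro sum.cong refl) (auto simp: m_assoc[symmetric])
  also have "\<dots> = (\<Sum>z\<in>P. \<Sum>y\<in>carrier S. f y * g (z \<otimes> y))"
    using P_carrier by (intro sum.cong refl sum_translate) auto
  also have "\<dots> = (\<Sum>z\<in>P. \<Sum>y\<in>carrier S. f y * g (inv z \<otimes> y))"
    by (rule sum_P_inv[of "\<lambda>z. \<Sum>y\<in>carrier S. f y * g (z \<otimes> y)", symmetric])
  also have "\<dots> = (\<Sum>y\<in>carrier S. f y * (\<Sum>z\<in>P. g (inv z \<otimes> y)))"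
    by (subst sum.swap) (simp add: sum_distrib_left)
  finally show ?thesis .
qed

text \<open>The usual argument for eigenvectors of a self-adjoint operator with distinct
  eigenvalues.\<close>

lemma orthogonal:
  assumes "a \<in> A" "b' \<in> A"
  shows "(\<Sum>x\<in>carrier S. \<epsilon> a x * \<epsilon> b' x) = (if a = b' then weight a else 0)"
proof -
  have "a * (\<Sum>x\<in>carrier S. \<epsilon> a x * \<epsilon> b' x) = b' * (\<Sum>x\<in>carrier S. \<epsilon> a x * \<epsilon> b' x)"
    using sum_P_self_adjoint[of "\<epsilon> a" "\<epsilon> b'"] assms
    by (simp add: eigen sum_distrib_left mult_ac)
  then show ?thesis by (auto simp: weight_def power2_eq_square)
qed

text \<open>By orthogonality, \<open>weight a\<close> is the pairing of \<open>\<epsilon> a\<close>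
  with the sum of all eigenfunctions, that is, with the point mass at the identity. Hence the
  weights form a probability distribution on \<open>A\<close>.\<close>

lemma weight_eq: "a \<in> A \<Longrightarrow> weight a = \<epsilon> a \<one>"
proof -
  assume a: "a \<in> A"
  have "weight a = (\<Sum>b'\<in>A. \<Sum>x\<in>carrier S. \<epsilon> a x * \<epsilon> b' x)"
    using a finite_A by (simp add: orthogonal)
  also have "\<dots> = (\<Sum>x\<in>carrier S. \<epsilon> a x * (if x = \<one> then 1 else 0))"
    by (subst sum.swap) (simp add: sum_eq flip: sum_distrib_left)
  also have "\<dots> = (\<Sum>x\<in>carrier S. if x = \<one> then \<epsilon> a x else 0)"
    by (intro sum.cong refl) simp
  also have "\<dots> = \<epsilon> a \<one>" using finite_carrier by simp
  finally show ?thesis .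
qed

lemma sum_weight: "sum weight A = 1"
  using sum_eq[of \<one>] by (simp add: weight_eq)

lemma weight_nonneg: "0 \<le> weight a"
  by (simp add: weight_def sum_nonneg)

text \<open>The sum over \<phi>(P^I) acts on the image of a tensor product of eigenfunctions in two
  ways: by Schur's scalar \<mu>, and by the product of the eigenvalues. So that image vanishes
  unless the two numbers agree.\<close>

lemma degree_bound:
  fixes G (structure) and I :: "'i set"
  assumes "group G" and finG: "finite (carrier G)" and irr: "is_irrep G n \<rho>"
    and I: "finite I" "I \<noteq> {}"
    and hom: "\<phi> \<in> hom (product_group I (\<lambda>_. S)) G" and inj: "inj_on \<phi> (I \<rightarrow>\<^sub>E carrier S)"
    and conj: "\<And>g x. \<lbrakk>g \<in> carrier G; x \<in> \<phi> ` (I \<rightarrow>\<^sub>E P)\<rbrakk> \<Longrightarrow> g \<otimes>\<^bsub>G\<^esub> x \<otimes>\<^bsub>G\<^esub> inv\<^bsub>G\<^esub> g \<in> \<phi> ` (I \<rightarrow>\<^sub>E P)"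
    and c: "\<And>a. a \<in> A \<Longrightarrow> weight a \<le> c"
  shows "(real n)\<^sup>2 \<le> c * real (order G)"
proof -
  interpret G: group G by fact
  define Q where "Q = product_group I (\<lambda>_. S)"
  interpret Q: group Q unfolding Q_def by (simp add: is_group)
  have carQ: "carrier Q = I \<rightarrow>\<^sub>E carrier S" by (simp add: Q_def)
  have finQ: "finite (carrier Q)" using I finite_carrier by (simp add: carQ finite_PiE)
  have PQ: "I \<rightarrow>\<^sub>E P \<subseteq> carrier Q" using P_carrier by (auto simp: carQ)
  have finP: "finite P" using P_carrier finite_carrier by (rule finite_subset)
  have rep: "is_rep G n \<rho>" and n: "n > 0" using irr by (auto simp: is_irrep_def)
  note \<rho>m = rep_mult_index[OF rep]
  have \<rho>c: "\<rho> g \<in> carrier_mat n n" if "g \<in> carrier G" for g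
    using rep that by (simp add: is_rep_def)
  have \<phi>c: "\<phi> x \<in> carrier G" if "x \<in> carrier Q" for x
    using hom that unfolding hom_def Q_def[symmetric] by auto
  have \<phi>m: "\<phi> (x \<otimes>\<^bsub>Q\<^esub> y) = \<phi> x \<otimes>\<^bsub>G\<^esub> \<phi> y" if "x \<in> carrier Q" "y \<in> carrier Q" for x y
    using hom that unfolding hom_def Q_def[symmetric] by auto
  have \<phi>1: "\<phi> \<one>\<^bsub>Q\<^esub> = \<one>\<^bsub>G\<^esub>"
    using hom Q.is_group G.is_group unfolding Q_def[symmetric] by (metis hom_one)
  define Z where "Z = mat n n (\<lambda>(i, j). \<Sum>x\<in>\<phi> ` (I \<rightarrow>\<^sub>E P). \<rho> x $$ (i, j))"
  have Zc: "Z \<in> carrier_mat n n" by (simp add: Z_def)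
  have "\<rho> g * Z = Z * \<rho> g" if g: "g \<in> carrier G" for g
  proof (rule eq_matI)
    fix i j assume "i < dim_row (Z * \<rho> g)" "j < dim_col (Z * \<rho> g)"
    then have ij: "i < n" "j < n" using Zc \<rho>c[OF g] by auto
    let ?C = "\<phi> ` (I \<rightarrow>\<^sub>E P)"
    have C: "?C \<subseteq> carrier G" using PQ \<phi>c by auto
    \<comment> \<open>Conjugation by g maps the set into itself, and conjugation by the inverse of g
      maps it back.\<close>
    have bij: "bij_betw (\<lambda>x. g \<otimes>\<^bsub>G\<^esub> x \<otimes>\<^bsub>G\<^esub> inv\<^bsub>G\<^esub> g) ?C ?C"
    proof (rule bij_betwI[where g = "\<lambda>x. inv\<^bsub>G\<^esub> g \<otimes>\<^bsub>G\<^esub> x \<otimes>\<^bsub>G\<^esub> g"])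
      show "(\<lambda>x. g \<otimes>\<^bsub>G\<^esub> x \<otimes>\<^bsub>G\<^esub> inv\<^bsub>G\<^esub> g) \<in> ?C \<rightarrow> ?C"
        using g conj by auto
      show "(\<lambda>x. inv\<^bsub>G\<^esub> g \<otimes>\<^bsub>G\<^esub> x \<otimes>\<^bsub>G\<^esub> g) \<in> ?C \<rightarrow> ?C"
        using g conj[of "inv\<^bsub>G\<^esub> g"] by auto
    next
      fix x assume "x \<in> ?C"
      then have "x \<in> carrier G" using C by auto
      then show "inv\<^bsub>G\<^esub> g \<otimes>\<^bsub>G\<^esub> (g \<otimes>\<^bsub>G\<^esub> x \<otimes>\<^bsub>G\<^esub> inv\<^bsub>G\<^esub> g) \<otimes>\<^bsub>G\<^esub> g = x"
        "g \<otimes>\<^bsub>G\<^esub> (inv\<^bsub>G\<^esub> g \<otimes>\<^bsub>G\<^esub> x \<otimes>\<^bsub>G\<^esub> g) \<otimes>\<^bsub>G\<^esub> inv\<^bsub>G\<^esub> g = x"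
        using g by (simp_all add: G.m_assoc) (simp_all add: G.m_assoc[symmetric])
    qed
    have "(\<rho> g * Z) $$ (i, j) = (\<Sum>x\<in>?C. \<Sum>m<n. \<rho> g $$ (i, m) * \<rho> x $$ (m, j))"
      using ij mat_mult_index_sum[OF \<rho>c[OF g] Zc ij] 
      by (subst sum.swap) (simp add: Z_def sum_distrib_left del: index_mult_mat(1))
    also have "\<dots> = (\<Sum>x\<in>?C. \<rho> ((g \<otimes>\<^bsub>G\<^esub> x \<otimes>\<^bsub>G\<^esub> inv\<^bsub>G\<^esub> g) \<otimes>\<^bsub>G\<^esub> g) $$ (i, j))"
      using C g ij by (intro sum.cong refl) (auto simp: \<rho>m[symmetric] G.m_assoc subset_iff)
    also have "\<dots> = (\<Sum>x\<in>?C. \<rho> (x \<otimes>\<^bsub>G\<^esub> g) $$ (i, j))"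
      by (rule sum.reindex_bij_betw[OF bij])
    also have "\<dots> = (\<Sum>x\<in>?C. \<Sum>m<n. \<rho> x $$ (i, m) * \<rho> g $$ (m, j))"
      using C g ij by (intro sum.cong refl \<rho>m) auto
    also have "\<dots> = (Z * \<rho> g) $$ (i, j)"
      using ij mat_mult_index_sum[OF Zc \<rho>c[OF g] ij] 
      by (subst sum.swap) (simp add: Z_def sum_distrib_right del: index_mult_mat(1))
    finally show "(\<rho> g * Z) $$ (i, j) = (Z * \<rho> g) $$ (i, j)" .
  qed (use Zc \<rho>c[OF g] in auto)
  from schur_scalar[OF irr Zc this] obtain \<mu> where \<mu>: "Z = \<mu> \<cdot>\<^sub>m 1\<^sub>m n" by auto
  \<comment> \<open>The tensor product of the eigenfunctions selected by \<open>\<tau>\<close>;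
    \<open>E \<tau>\<close> is its image under the linear extension of \<rho> to the group
    algebra.\<close>
  define eT where "eT \<tau> x = (\<Prod>i\<in>I. \<epsilon> (\<tau> i) (x i))" for \<tau> x
  define E where "E \<tau> = mat n n (\<lambda>(i, j). \<Sum>x\<in>carrier Q. of_real (eT \<tau> x) * \<rho> (\<phi> x) $$ (i, j))" for \<tau>
  have Ec: "E \<tau> \<in> carrier_mat n n" for \<tau> by (simp add: E_def)
  have eigT: "(\<Sum>z\<in>I \<rightarrow>\<^sub>E P. eT \<tau> (inv\<^bsub>Q\<^esub> z \<otimes>\<^bsub>Q\<^esub> x)) = (\<Prod>i\<in>I. \<tau> i) * eT \<tau> x"
    if \<tau>: "\<tau> \<in> I \<rightarrow>\<^sub>E A" and x: "x \<in> carrier Q" for \<tau> x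
  proof -
    have "(\<Sum>z\<in>I \<rightarrow>\<^sub>E P. eT \<tau> (inv\<^bsub>Q\<^esub> z \<otimes>\<^bsub>Q\<^esub> x)) = (\<Sum>z\<in>I \<rightarrow>\<^sub>E P. \<Prod>i\<in>I. \<epsilon> (\<tau> i) (inv (z i) \<otimes> x i))"
    proof (intro sum.cong refl)
      fix z assume "z \<in> I \<rightarrow>\<^sub>E P"
      then have "z \<in> carrier Q" using PQ by auto
      then have "inv\<^bsub>Q\<^esub> z = (\<lambda>i\<in>I. inv (z i))"
        unfolding Q_def by (intro inv_product_group) (auto simp: is_group)
      then show "eT \<tau> (inv\<^bsub>Q\<^esub> z \<otimes>\<^bsub>Q\<^esub> x) = (\<Prod>i\<in>I. \<epsilon> (\<tau> i) (inv (z i) \<otimes> x i))"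
        by (simp add: eT_def Q_def)
    qed
    also have "\<dots> = (\<Prod>i\<in>I. \<Sum>z\<in>P. \<epsilon> (\<tau> i) (inv z \<otimes> x i))"
      using I finP by (simp add: prod_sum_PiE)
    also have "\<dots> = (\<Prod>i\<in>I. \<tau> i * \<epsilon> (\<tau> i) (x i))"
      using \<tau> x by (intro prod.cong refl eigen) (auto simp: carQ)
    finally show ?thesis by (simp add: prod.distrib eT_def)
  qed
  have tr0: "(\<Sum>x\<in>carrier Q. of_real (eT \<tau> x) * mat_trace (\<rho> (\<phi> x))) = 0"
    if \<tau>: "\<tau> \<in> I \<rightarrow>\<^sub>E A" and ne: "of_real (\<Prod>i\<in>I. \<tau> i) \<noteq> \<mu>" for \<tau>
  proof -
    let ?r = "of_real (\<Prod>i\<in>I. \<tau> i) :: complex"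
    have E0: "E \<tau> $$ (i, j) = 0" if ij: "i < n" "j < n" for i j
    proof -
      have inj': "inj_on \<phi> (I \<rightarrow>\<^sub>E P)" using inj PQ carQ by (auto intro: inj_on_subset)
      \<comment> \<open>The product \<open>Z * E \<tau>\<close> is rewritten as the image of the
        convolution of P^I with \<open>eT \<tau>\<close>, which \<open>eigT\<close>
        evaluates.\<close>
      have "\<mu> * E \<tau> $$ (i, j) = (Z * E \<tau>) $$ (i, j)"
        unfolding \<mu> using ij Ec[of \<tau>] by (subst mult_smult_assoc_mat[of _ n n _ n]) auto
      also have "\<dots> = (\<Sum>m<n. (\<Sum>z\<in>I \<rightarrow>\<^sub>E P. \<rho> (\<phi> z) $$ (i, m)) * (\<Sum>x\<in>carrier Q. of_real (eT \<tau> x) * \<rho> (\<phi> x) $$ (m, j)))"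
        using ij mat_mult_index_sum[OF Zc Ec ij]
        by (simp add: Z_def E_def sum.reindex[OF inj'] del: index_mult_mat(1))
      also have "\<dots> = (\<Sum>m<n. \<Sum>z\<in>I \<rightarrow>\<^sub>E P. \<Sum>x\<in>carrier Q. \<rho> (\<phi> z) $$ (i, m) * (of_real (eT \<tau> x) * \<rho> (\<phi> x) $$ (m, j)))"
        by (simp only: sum_product)
      also have "\<dots> = (\<Sum>z\<in>I \<rightarrow>\<^sub>E P. \<Sum>m<n. \<Sum>x\<in>carrier Q. \<rho> (\<phi> z) $$ (i, m) * (of_real (eT \<tau> x) * \<rho> (\<phi> x) $$ (m, j)))"
        by (rule sum.swap)
      also have "\<dots> = (\<Sum>z\<in>I \<rightarrow>\<^sub>E P. \<Sum>x\<in>carrier Q. \<Sum>m<n. \<rho> (\<phi> z) $$ (i, m) * (of_real (eT \<tau> x) * \<rho> (\<phi> x) $$ (m, j)))"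
        by (intro sum.cong refl) (rule sum.swap)
      also have "\<dots> = (\<Sum>z\<in>I \<rightarrow>\<^sub>E P. \<Sum>x\<in>carrier Q. of_real (eT \<tau> x) * (\<Sum>m<n. \<rho> (\<phi> z) $$ (i, m) * \<rho> (\<phi> x) $$ (m, j)))"
        by (simp add: sum_distrib_left mult_ac)
      also have "\<dots> = (\<Sum>z\<in>I \<rightarrow>\<^sub>E P. \<Sum>x\<in>carrier Q. of_real (eT \<tau> (inv\<^bsub>Q\<^esub> z \<otimes>\<^bsub>Q\<^esub> (z \<otimes>\<^bsub>Q\<^esub> x))) * \<rho> (\<phi> (z \<otimes>\<^bsub>Q\<^esub> x)) $$ (i, j))"
        using ij PQ by (intro sum.cong refl) (auto simp: \<rho>m \<phi>m \<phi>c Q.m_assoc[symmetric] subset_iff)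
      also have "\<dots> = (\<Sum>z\<in>I \<rightarrow>\<^sub>E P. \<Sum>x\<in>carrier Q. of_real (eT \<tau> (inv\<^bsub>Q\<^esub> z \<otimes>\<^bsub>Q\<^esub> x)) * \<rho> (\<phi> x) $$ (i, j))"
        using PQ by (intro sum.cong refl Q.sum_translate) auto
      also have "\<dots> = (\<Sum>x\<in>carrier Q. of_real (\<Sum>z\<in>I \<rightarrow>\<^sub>E P. eT \<tau> (inv\<^bsub>Q\<^esub> z \<otimes>\<^bsub>Q\<^esub> x)) * \<rho> (\<phi> x) $$ (i, j))"
        by (subst sum.swap) (simp add: sum_distrib_right)
      also have "\<dots> = ?r * E \<tau> $$ (i, j)"
        using ij by (simp add: eigT[OF \<tau>] E_def sum_distrib_left mult_ac)
      finally show ?thesis using ne by simp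
    qed
    have "(\<Sum>x\<in>carrier Q. of_real (eT \<tau> x) * mat_trace (\<rho> (\<phi> x))) = (\<Sum>i<n. E \<tau> $$ (i, i))"
    proof -
      have "dim_row (\<rho> (\<phi> x)) = n" if "x \<in> carrier Q" for x
        using \<rho>c[OF \<phi>c[OF that]] by simp
      then have "(\<Sum>x\<in>carrier Q. of_real (eT \<tau> x) * mat_trace (\<rho> (\<phi> x)))
         = (\<Sum>x\<in>carrier Q. \<Sum>i<n. of_real (eT \<tau> x) * \<rho> (\<phi> x) $$ (i, i))"
        by (intro sum.cong refl) (simp add: mat_trace_def sum_distrib_left)
      then show ?thesis by (subst (asm) sum.swap) (simp add: E_def)
    qed
    then show ?thesis by (simp add: E0)
  qed
  define B where "B = {\<tau> \<in> I \<rightarrow>\<^sub>E A. of_real (\<Prod>i\<in>I. \<tau> i) = \<mu>}"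
  have finA: "finite (I \<rightarrow>\<^sub>E A)" using I finite_A by (simp add: finite_PiE)
  have B: "B \<subseteq> I \<rightarrow>\<^sub>E A" by (auto simp: B_def)
  have finB: "finite B" using B finA by (rule finite_subset)
  define h where "h x = (\<Sum>\<tau>\<in>B. eT \<tau> x)" for x
  have sumeT: "(\<Sum>\<tau>\<in>I \<rightarrow>\<^sub>E A. eT \<tau> x) = (if x = \<one>\<^bsub>Q\<^esub> then 1 else 0)" if x: "x \<in> carrier Q" for x
  proof -
    have "(\<Sum>\<tau>\<in>I \<rightarrow>\<^sub>E A. eT \<tau> x) = (\<Prod>i\<in>I. \<Sum>a\<in>A. \<epsilon> a (x i))"
      using I finite_A by (simp add: prod_sum_PiE eT_def)
    also have "\<dots> = (\<Prod>i\<in>I. if x i = \<one> then 1 else 0)"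
      using x by (intro prod.cong refl sum_eq) (auto simp: carQ)
    also have "\<dots> = (if \<forall>i\<in>I. x i = \<one> then 1 else 0)"
      using I(1) by auto
    also have "(\<forall>i\<in>I. x i = \<one>) \<longleftrightarrow> x = \<one>\<^bsub>Q\<^esub>"
      using x by (auto simp: carQ Q_def fun_eq_iff PiE_iff extensional_def)
    finally show ?thesis .
  qed
  \<comment> \<open>By \<open>tr0\<close> the tensors outside \<open>B\<close> contribute no trace,
    so \<open>h\<close> may be replaced by the sum of all tensors. That sum is the point mass at the
    identity, whose trace is n.\<close>
  have "(\<Sum>x\<in>carrier Q. of_real (h x) * mat_trace (\<rho> (\<phi> x)))
      = (\<Sum>\<tau>\<in>B. \<Sum>x\<in>carrier Q. of_real (eT \<tau> x) * mat_trace (\<rho> (\<phi> x)))"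
    by (subst sum.swap) (simp add: h_def sum_distrib_right)
  also have "\<dots> = (\<Sum>\<tau>\<in>I \<rightarrow>\<^sub>E A. \<Sum>x\<in>carrier Q. of_real (eT \<tau> x) * mat_trace (\<rho> (\<phi> x)))"
    using finA B by (intro sum.mono_neutral_left) (auto simp: tr0 B_def)
  also have "\<dots> = (\<Sum>x\<in>carrier Q. of_real (\<Sum>\<tau>\<in>I \<rightarrow>\<^sub>E A. eT \<tau> x) * mat_trace (\<rho> (\<phi> x)))"
    by (subst sum.swap) (simp add: sum_distrib_right)
  also have "\<dots> = (\<Sum>x\<in>carrier Q. if x = \<one>\<^bsub>Q\<^esub> then mat_trace (\<rho> (\<phi> x)) else 0)"
    by (intro sum.cong refl) (simp add: sumeT)
  also have "\<dots> = of_nat n"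
    using finQ rep by (simp add: \<phi>1 is_rep_def mat_trace_def)
  finally have "(real n)\<^sup>2 \<le> real (order G) * (\<Sum>x\<in>carrier Q. (h x)\<^sup>2)"
    using \<phi>c inj by (intro G.degree_bound_of_trace[OF finG irr, where \<phi> = \<phi>]) (auto simp: carQ)
  moreover have "(\<Sum>x\<in>carrier Q. (h x)\<^sup>2) \<le> c"
  proof -
    have orthT: "(\<Sum>x\<in>carrier Q. eT \<tau> x * eT \<sigma> x) = (if \<sigma> = \<tau> then \<Prod>i\<in>I. weight (\<tau> i) else 0)"
      if "\<tau> \<in> B" "\<sigma> \<in> B" for \<tau> \<sigma>
    proof -
      have \<tau>\<sigma>: "\<tau> \<in> I \<rightarrow>\<^sub>E A" "\<sigma> \<in> I \<rightarrow>\<^sub>E A" using that B by auto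
      have "(\<Sum>x\<in>carrier Q. eT \<tau> x * eT \<sigma> x) = (\<Prod>i\<in>I. \<Sum>x\<in>carrier S. \<epsilon> (\<tau> i) x * \<epsilon> (\<sigma> i) x)"
        using I finite_carrier by (simp add: prod_sum_PiE eT_def carQ prod.distrib)
      also have "\<dots> = (\<Prod>i\<in>I. if \<tau> i = \<sigma> i then weight (\<tau> i) else 0)"
        using \<tau>\<sigma> by (intro prod.cong refl orthogonal) auto
      also have "\<dots> = (if \<forall>i\<in>I. \<tau> i = \<sigma> i then \<Prod>i\<in>I. weight (\<tau> i) else 0)"
        using I(1) by auto
      also have "(\<forall>i\<in>I. \<tau> i = \<sigma> i) \<longleftrightarrow> \<sigma> = \<tau>"
        using \<tau>\<sigma> by (metis PiE_ext)
      finally show ?thesis .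
    qed
    have "(\<Sum>x\<in>carrier Q. (h x)\<^sup>2) = (\<Sum>\<tau>\<in>B. \<Sum>\<sigma>\<in>B. \<Sum>x\<in>carrier Q. eT \<tau> x * eT \<sigma> x)"
      unfolding h_def power2_eq_square sum_product
      by (subst sum.swap, intro sum.cong refl, subst sum.swap, simp)
    also have "\<dots> = (\<Sum>\<tau>\<in>B. \<Prod>i\<in>I. weight (\<tau> i))"
      using finB by (intro sum.cong refl) (simp add: orthT)
    also have "\<dots> \<le> c"
    proof (cases "B = {}")
      case True
      have "A \<noteq> {}" using sum_weight by auto
      then have "0 \<le> c" using c weight_nonneg by (meson all_not_in_conv order_trans)
      then show ?thesis using True by simp
    next
      case False
      \<comment> \<open>Schur's scalar is a complex number; a member of \<open>B\<close> shows that
        it is a product of real eigenvalues, so the counting lemma over the reals applies.\<close>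
      then obtain \<tau>0 where "of_real (\<Prod>i\<in>I. \<tau>0 i) = \<mu>" by (auto simp: B_def)
      then have "B = {\<tau>. \<tau> \<in> I \<rightarrow>\<^sub>E A \<and> (\<Prod>i\<in>I. \<tau> i) = (\<Prod>i\<in>I. \<tau>0 i)}"
        unfolding B_def by (metis (mono_tags, lifting) of_real_eq_iff)
      then show ?thesis
        using sum_PiE_prod_eq_le[OF I finite_A zero_notin_A weight_nonneg c sum_weight, of "\<Prod>i\<in>I. \<tau>0 i"]
        by simp
    qed
    finally show ?thesis .
  qed
  then have "real (order G) * (\<Sum>x\<in>carrier Q. (h x)\<^sup>2) \<le> real (order G) * c"
    by (rule mult_left_mono) simp
  ultimately show ?thesis by (simp add: mult.commute)
qed

end

section \<open>Elements of SL2 with a fixed vector\<close>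

context field
begin

definition act :: "'a \<times> 'a \<times> 'a \<times> 'a \<Rightarrow> 'a \<times> 'a \<Rightarrow> 'a \<times> 'a" where
  "act = (\<lambda>(a, e, c, d) (x, y). (a \<otimes> x \<oplus> e \<otimes> y, c \<otimes> x \<oplus> d \<otimes> y))"

text \<open>The symplectic form preserved by SL2. For nonzero vectors its vanishing means that they
  span the same line, which is how points of the projective line are compared.\<close>

definition det2 :: "'a \<times> 'a \<Rightarrow> 'a \<times> 'a \<Rightarrow> 'a" where
  "det2 = (\<lambda>(x, y) (z, w). x \<otimes> w \<ominus> y \<otimes> z)"

definition scale2 :: "'a \<Rightarrow> 'a \<times> 'a \<Rightarrow> 'a \<times> 'a" where
  "scale2 r = (\<lambda>(x, y). (r \<otimes> x, r \<otimes> y))"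

definition vecs :: "('a \<times> 'a) set" where
  "vecs = carrier R \<times> carrier R - {(\<zero>, \<zero>)}"

lemma act_simp [simp]: "act (a, e, c, d) (x, y) = (a \<otimes> x \<oplus> e \<otimes> y, c \<otimes> x \<oplus> d \<otimes> y)"
  by (simp add: act_def)

lemma det2_simp [simp]: "det2 (x, y) (z, w) = x \<otimes> w \<ominus> y \<otimes> z"
  by (simp add: det2_def)

lemma scale2_simp [simp]: "scale2 r (x, y) = (r \<otimes> x, r \<otimes> y)"
  by (simp add: scale2_def)

lemma vecs_iff: "(x, y) \<in> vecs \<longleftrightarrow> x \<in> carrier R \<and> y \<in> carrier R \<and> (x \<noteq> \<zero> \<or> y \<noteq> \<zero>)"
  by (auto simp: vecs_def)

lemma SL2_carrier_iff:
  "(a, e, c, d) \<in> carrier (SL2 R) \<longleftrightarrow>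
    a \<in> carrier R \<and> e \<in> carrier R \<and> c \<in> carrier R \<and> d \<in> carrier R \<and> a \<otimes> d \<ominus> e \<otimes> c = \<one>"
  by (simp add: SL2_def)

lemma SL2_mult:
  "(a, e, c, d) \<otimes>\<^bsub>SL2 R\<^esub> (x, y, z, w) =
    (a \<otimes> x \<oplus> e \<otimes> z, a \<otimes> y \<oplus> e \<otimes> w, c \<otimes> x \<oplus> d \<otimes> z, c \<otimes> y \<oplus> d \<otimes> w)"
  by (simp add: SL2_def)

lemma SL2_one: "\<one>\<^bsub>SL2 R\<^esub> = (\<one>, \<zero>, \<zero>, \<one>)"
  by (simp add: SL2_def)

lemma group_SL2: "group (SL2 R)"
proof (rule groupI)
  fix M N assume M: "M \<in> carrier (SL2 R)" and N: "N \<in> carrier (SL2 R)"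
  obtain a e c d where M': "M = (a, e, c, d)" by (cases M)
  obtain x y z w where N': "N = (x, y, z, w)" by (cases N)
  have cs [simp]: "a \<in> carrier R" "e \<in> carrier R" "c \<in> carrier R" "d \<in> carrier R"
     "x \<in> carrier R" "y \<in> carrier R" "z \<in> carrier R" "w \<in> carrier R"
    using M N by (auto simp: M' N' SL2_carrier_iff)
  have "(a \<otimes> x \<oplus> e \<otimes> z) \<otimes> (c \<otimes> y \<oplus> d \<otimes> w) \<ominus> (a \<otimes> y \<oplus> e \<otimes> w) \<otimes> (c \<otimes> x \<oplus> d \<otimes> z)
      = (a \<otimes> d \<ominus> e \<otimes> c) \<otimes> (x \<otimes> w \<ominus> y \<otimes> z)"
    using cs by algebra
  then show "M \<otimes>\<^bsub>SL2 R\<^esub> N \<in> carrier (SL2 R)"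
    using M N by (simp add: M' N' SL2_mult SL2_carrier_iff)
  fix K assume K: "K \<in> carrier (SL2 R)"
  obtain p q r s where K': "K = (p, q, r, s)" by (cases K)
  have cs' [simp]: "p \<in> carrier R" "q \<in> carrier R" "r \<in> carrier R" "s \<in> carrier R"
    using K by (auto simp: K' SL2_carrier_iff)
  show "M \<otimes>\<^bsub>SL2 R\<^esub> N \<otimes>\<^bsub>SL2 R\<^esub> K = M \<otimes>\<^bsub>SL2 R\<^esub> (N \<otimes>\<^bsub>SL2 R\<^esub> K)"
    unfolding M' N' K' SL2_mult prod.inject using cs cs' by (intro conjI; algebra)
next
  show "\<one>\<^bsub>SL2 R\<^esub> \<in> carrier (SL2 R)"
    by (simp add: SL2_one SL2_carrier_iff minus_eq)
next
  fix M assume M: "M \<in> carrier (SL2 R)"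
  obtain a e c d where M': "M = (a, e, c, d)" by (cases M)
  have cs [simp]: "a \<in> carrier R" "e \<in> carrier R" "c \<in> carrier R" "d \<in> carrier R"
    using M by (auto simp: M' SL2_carrier_iff)
  have det: "a \<otimes> d \<ominus> e \<otimes> c = \<one>" using M by (simp add: M' SL2_carrier_iff)
  show "\<one>\<^bsub>SL2 R\<^esub> \<otimes>\<^bsub>SL2 R\<^esub> M = M"
    by (simp add: SL2_one M' SL2_mult)
  have "d \<otimes> a \<ominus> (\<ominus> e) \<otimes> (\<ominus> c) = a \<otimes> d \<ominus> e \<otimes> c" "d \<otimes> a \<oplus> (\<ominus> e) \<otimes> c = a \<otimes> d \<ominus> e \<otimes> c"
    "d \<otimes> e \<oplus> (\<ominus> e) \<otimes> d = \<zero>" "(\<ominus> c) \<otimes> a \<oplus> a \<otimes> c = \<zero>" "(\<ominus> c) \<otimes> e \<oplus> a \<otimes> d = a \<otimes> d \<ominus> e \<otimes> c"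
    using cs by algebra+
  then have "(d, \<ominus> e, \<ominus> c, a) \<otimes>\<^bsub>SL2 R\<^esub> M = \<one>\<^bsub>SL2 R\<^esub> \<and> (d, \<ominus> e, \<ominus> c, a) \<in> carrier (SL2 R)"
    by (simp add: M' SL2_mult SL2_one SL2_carrier_iff det)
  then show "\<exists>N\<in>carrier (SL2 R). N \<otimes>\<^bsub>SL2 R\<^esub> M = \<one>\<^bsub>SL2 R\<^esub>" by blast
qed

lemma act_closed: "M \<in> carrier (SL2 R) \<Longrightarrow> v \<in> carrier R \<times> carrier R \<Longrightarrow> act M v \<in> carrier R \<times> carrier R"
  by (cases M; cases v) (auto simp: SL2_carrier_iff)

lemma act_one: "v \<in> carrier R \<times> carrier R \<Longrightarrow> act \<one>\<^bsub>SL2 R\<^esub> v = v"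
  by (cases v) (auto simp: SL2_one)

lemma act_mult:
  assumes "M \<in> carrier (SL2 R)" "N \<in> carrier (SL2 R)" "v \<in> carrier R \<times> carrier R"
  shows "act (M \<otimes>\<^bsub>SL2 R\<^esub> N) v = act M (act N v)"
proof -
  obtain a e c d where M': "M = (a, e, c, d)" by (cases M)
  obtain x y z w where N': "N = (x, y, z, w)" by (cases N)
  obtain p q where v': "v = (p, q)" by (cases v)
  have cs [simp]: "a \<in> carrier R" "e \<in> carrier R" "c \<in> carrier R" "d \<in> carrier R"
     "x \<in> carrier R" "y \<in> carrier R" "z \<in> carrier R" "w \<in> carrier R" "p \<in> carrier R" "q \<in> carrier R"
    using assms by (auto simp: M' N' v' SL2_carrier_iff)
  show ?thesis
    unfolding M' N' v' SL2_mult act_simp prod.inject using cs by (intro conjI; algebra)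
qed

lemma det2_act:
  assumes "M \<in> carrier (SL2 R)" "v \<in> carrier R \<times> carrier R" "w \<in> carrier R \<times> carrier R"
  shows "det2 (act M v) (act M w) = det2 v w"
proof -
  obtain a e c d where M': "M = (a, e, c, d)" by (cases M)
  obtain x y where v': "v = (x, y)" by (cases v)
  obtain p q where w': "w = (p, q)" by (cases w)
  have cs [simp]: "a \<in> carrier R" "e \<in> carrier R" "c \<in> carrier R" "d \<in> carrier R"
     "x \<in> carrier R" "y \<in> carrier R" "p \<in> carrier R" "q \<in> carrier R"
    using assms by (auto simp: M' v' w' SL2_carrier_iff)
  have "(a \<otimes> x \<oplus> e \<otimes> y) \<otimes> (c \<otimes> p \<oplus> d \<otimes> q) \<ominus> (c \<otimes> x \<oplus> d \<otimes> y) \<otimes> (a \<otimes> p \<oplus> e \<otimes> q)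
     = (a \<otimes> d \<ominus> e \<otimes> c) \<otimes> (x \<otimes> q \<ominus> y \<otimes> p)" using cs by algebra
  then show ?thesis using assms(1) by (simp add: M' v' w' SL2_carrier_iff)
qed

lemma act_scale2:
  assumes "M \<in> carrier (SL2 R)" "v \<in> carrier R \<times> carrier R" "r \<in> carrier R"
  shows "act M (scale2 r v) = scale2 r (act M v)"
proof -
  obtain a e c d where M': "M = (a, e, c, d)" by (cases M)
  obtain x y where v': "v = (x, y)" by (cases v)
  have cs [simp]: "a \<in> carrier R" "e \<in> carrier R" "c \<in> carrier R" "d \<in> carrier R"
     "x \<in> carrier R" "y \<in> carrier R" "r \<in> carrier R"
    using assms by (auto simp: M' v' SL2_carrier_iff)
  show ?thesis
    unfolding M' v' scale2_simp act_simp prod.inject using cs by (intro conjI; algebra)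
qed

lemma det2_scale2_right:
  assumes "v \<in> carrier R \<times> carrier R" "w \<in> carrier R \<times> carrier R" "r \<in> carrier R"
  shows "det2 v (scale2 r w) = r \<otimes> det2 v w"
proof -
  obtain x y where v': "v = (x, y)" by (cases v)
  obtain z w' where w': "w = (z, w')" by (cases w)
  have cs [simp]: "x \<in> carrier R" "y \<in> carrier R" "z \<in> carrier R" "w' \<in> carrier R" "r \<in> carrier R"
    using assms by (auto simp: v' w')
  show ?thesis unfolding v' w' scale2_simp det2_simp using cs by algebra
qed

lemma det2_self: "v \<in> carrier R \<times> carrier R \<Longrightarrow> det2 v v = \<zero>"
  by (cases v) (auto simp: m_comm r_neg minus_eq)

lemma det2_closed: "v \<in> carrier R \<times> carrier R \<Longrightarrow> w \<in> carrier R \<times> carrier R \<Longrightarrow> det2 v w \<in> carrier R"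
  by (cases v; cases w) auto

lemma det2_zero_swap:
  assumes "v \<in> carrier R \<times> carrier R" "w \<in> carrier R \<times> carrier R"
  shows "det2 v w = \<zero> \<longleftrightarrow> det2 w v = \<zero>"
proof -
  obtain x y z w' where v': "v = (x, y)" "w = (z, w')" by (cases v; cases w) auto
  have cs [simp]: "x \<in> carrier R" "y \<in> carrier R" "z \<in> carrier R" "w' \<in> carrier R"
    using assms by (auto simp: v')
  have "x \<otimes> w' \<ominus> y \<otimes> z = \<ominus> (z \<otimes> y \<ominus> w' \<otimes> x)" using cs by algebra
  then show ?thesis by (simp add: v')
qed

lemma vecs_carrier: "v \<in> vecs \<Longrightarrow> v \<in> carrier R \<times> carrier R"
  by (auto simp: vecs_def)

lemma scale2_vecs:
  assumes "v \<in> vecs" "r \<in> carrier R - {\<zero>}"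
  shows "scale2 r v \<in> vecs"
  using assms by (cases v) (auto simp: vecs_iff integral_iff)

lemma act_vecs:
  assumes "M \<in> carrier (SL2 R)" "v \<in> vecs"
  shows "act M v \<in> vecs"
proof -
  interpret S: group "SL2 R" by (rule group_SL2)
  have v: "v \<in> carrier R \<times> carrier R" using assms(2) by (rule vecs_carrier)
  have "act M v \<noteq> (\<zero>, \<zero>)"
  proof
    assume 0: "act M v = (\<zero>, \<zero>)"
    have "v = act (inv\<^bsub>SL2 R\<^esub> M) (act M v)"
      using assms(1) v by (simp add: act_mult[symmetric] act_one)
    also have "\<dots> = (\<zero>, \<zero>)"
      unfolding 0 using S.inv_closed[OF assms(1)]
      by (cases "inv\<^bsub>SL2 R\<^esub> M") (auto simp: SL2_carrier_iff)
    finally show False using assms(2) by (simp add: vecs_def)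
  qed
  then show ?thesis using act_closed[OF assms(1) v] by (simp add: vecs_def)
qed

lemma det2_zero_imp_scale2:
  assumes "v \<in> vecs" "w \<in> vecs" "det2 v w = \<zero>"
  shows "\<exists>r\<in>carrier R - {\<zero>}. w = scale2 r v"
proof -
  obtain x y z w' where v': "v = (x, y)" "w = (z, w')" by (cases v; cases w) auto
  have cs [simp]: "x \<in> carrier R" "y \<in> carrier R" "z \<in> carrier R" "w' \<in> carrier R"
    using assms by (auto simp: v' vecs_iff)
  have eq: "x \<otimes> w' = y \<otimes> z" using assms(3) by (simp add: v')
  have "\<exists>r\<in>carrier R. w = scale2 r v"
  proof (cases "x = \<zero>")
    case False
    then have u: "x \<in> Units R" by (simp add: field_Units)
    then have [simp]: "inv x \<in> carrier R" by simp
    have "z = (z \<otimes> inv x) \<otimes> x" using u by (simp add: m_assoc)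
    moreover have "(z \<otimes> inv x) \<otimes> y = (y \<otimes> z) \<otimes> inv x" using cs \<open>inv x \<in> carrier R\<close> by algebra
    moreover have "\<dots> = (x \<otimes> inv x) \<otimes> w'" unfolding eq[symmetric] using cs \<open>inv x \<in> carrier R\<close> by algebra
    ultimately have "w = scale2 (z \<otimes> inv x) v" using u by (simp add: v')
    then show ?thesis by (intro bexI[of _ "z \<otimes> inv x"]) auto
  next
    case True
    then have y: "y \<noteq> \<zero>" using assms(1) by (auto simp: v' vecs_iff)
    then have u: "y \<in> Units R" by (simp add: field_Units)
    then have [simp]: "inv y \<in> carrier R" by simp
    have "y \<otimes> z = \<zero>" using eq True by simp
    then have "z = \<zero>" using y integral_iff[of y z] by simp
    moreover have "w' = (w' \<otimes> inv y) \<otimes> y" using u by (simp add: m_assoc)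
    ultimately have "w = scale2 (w' \<otimes> inv y) v" using True by (simp add: v')
    then show ?thesis by (intro bexI[of _ "w' \<otimes> inv y"]) auto
  qed
  then obtain r where r: "r \<in> carrier R" "w = scale2 r v" by auto
  have "r \<noteq> \<zero>" using r assms(2) by (auto simp: v' vecs_iff)
  with r show ?thesis by auto
qed

lemma scale2_eq_iff:
  assumes "v \<in> vecs" "r \<in> carrier R" "s \<in> carrier R"
  shows "scale2 r v = scale2 s v \<longleftrightarrow> r = s"
  using assms by (cases v) (auto simp: vecs_iff m_rcancel)

lemma SL2_transitive:
  assumes "v \<in> vecs"
  shows "\<exists>M\<in>carrier (SL2 R). act M (\<one>, \<zero>) = v"
proof -
  obtain x y where v': "v = (x, y)" by (cases v)
  have cs [simp]: "x \<in> carrier R" "y \<in> carrier R" using assms by (auto simp: v' vecs_iff)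
  show ?thesis
  proof (cases "x = \<zero>")
    case False
    then have u: "x \<in> Units R" by (simp add: field_Units)
    \<comment> \<open>The first column has to be v; the second one only has to make the determinant
      1.\<close>
    then show ?thesis by (intro bexI[of _ "(x, \<zero>, y, inv x)"]) (auto simp: v' SL2_carrier_iff minus_eq)
  next
    case True
    then have y: "y \<noteq> \<zero>" using assms by (auto simp: v' vecs_iff)
    then have u: "y \<in> Units R" by (simp add: field_Units)
    then have "\<zero> \<otimes> \<zero> \<ominus> (\<ominus> (inv y)) \<otimes> y = \<one>" by (simp add: minus_eq l_minus)
    with u show ?thesis
      by (intro bexI[of _ "(\<zero>, \<ominus> (inv y), y, \<zero>)"]) (auto simp: True v' SL2_carrier_iff)
  qed
qed

text \<open>These are exactly the unipotent elements.\<close>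

definition SL2_fix :: "('a \<times> 'a \<times> 'a \<times> 'a) set" where
  "SL2_fix = {u \<in> carrier (SL2 R). \<exists>v\<in>vecs. act u v = v}"

text \<open>A fixed vector exists iff M - 1 is singular, and det(M - 1) = det M + 1 - tr M = 2 - tr
  M.\<close>

lemma SL2_fix_iff_trace:
  assumes "(a, e, c, d) \<in> carrier (SL2 R)"
  shows "(a, e, c, d) \<in> SL2_fix \<longleftrightarrow> a \<oplus> d = \<one> \<oplus> \<one>"
proof -
  have cs [simp]: "a \<in> carrier R" "e \<in> carrier R" "c \<in> carrier R" "d \<in> carrier R"
    and det: "a \<otimes> d \<ominus> e \<otimes> c = \<one>"
    using assms by (auto simp: SL2_carrier_iff)
  have id: "(a \<ominus> \<one>) \<otimes> (d \<ominus> \<one>) \<ominus> e \<otimes> c = (a \<otimes> d \<ominus> e \<otimes> c) \<oplus> \<one> \<ominus> (a \<oplus> d)" using cs by algebra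
  have "\<one> \<oplus> \<one> \<ominus> (a \<oplus> d) = \<zero> \<longleftrightarrow> a \<oplus> d = \<one> \<oplus> \<one>" by (metis add.m_closed one_closed r_right_minus_eq \<open>a \<in> carrier R\<close> \<open>d \<in> carrier R\<close>)
  then have tr: "a \<oplus> d = \<one> \<oplus> \<one> \<longleftrightarrow> (a \<ominus> \<one>) \<otimes> (d \<ominus> \<one>) \<ominus> e \<otimes> c = \<zero>"
    unfolding id det by simp
  have fix_iff: "act (a, e, c, d) (x, y) = (x, y) \<longleftrightarrow> (a \<ominus> \<one>) \<otimes> x \<oplus> e \<otimes> y = \<zero> \<and> c \<otimes> x \<oplus> (d \<ominus> \<one>) \<otimes> y = \<zero>"
    if cs2 [simp]: "x \<in> carrier R" "y \<in> carrier R" for x y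
  proof -
    have "(a \<ominus> \<one>) \<otimes> x \<oplus> e \<otimes> y = (a \<otimes> x \<oplus> e \<otimes> y) \<ominus> x" "c \<otimes> x \<oplus> (d \<ominus> \<one>) \<otimes> y = (c \<otimes> x \<oplus> d \<otimes> y) \<ominus> y"
      using cs cs2 by algebra+
    then show ?thesis by (simp add: act_simp)
  qed
  have "(a, e, c, d) \<in> SL2_fix \<longleftrightarrow> (a \<ominus> \<one>) \<otimes> (d \<ominus> \<one>) \<ominus> e \<otimes> c = \<zero>"
  proof
    assume "(a, e, c, d) \<in> SL2_fix"
    then obtain x y where v: "(x, y) \<in> vecs" and f: "act (a, e, c, d) (x, y) = (x, y)"
      by (auto simp: SL2_fix_def)
    then have cs2 [simp]: "x \<in> carrier R" "y \<in> carrier R" and nz: "x \<noteq> \<zero> \<or> y \<noteq> \<zero>" by (auto simp: vecs_iff)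
    note f = f[unfolded fix_iff[OF \<open>x \<in> carrier R\<close> \<open>y \<in> carrier R\<close>]]
    \<comment> \<open>Multiplying (M - 1)v = 0 by the adjugate of M - 1 gives D v = 0.\<close>
    let ?D = "(a \<ominus> \<one>) \<otimes> (d \<ominus> \<one>) \<ominus> e \<otimes> c"
    have "?D \<otimes> x = (d \<ominus> \<one>) \<otimes> ((a \<ominus> \<one>) \<otimes> x \<oplus> e \<otimes> y) \<ominus> e \<otimes> (c \<otimes> x \<oplus> (d \<ominus> \<one>) \<otimes> y)" using cs cs2 by algebra
    then have 1: "?D \<otimes> x = \<zero>" using f by (simp add: minus_eq)
    have "?D \<otimes> y = (a \<ominus> \<one>) \<otimes> (c \<otimes> x \<oplus> (d \<ominus> \<one>) \<otimes> y) \<ominus> c \<otimes> ((a \<ominus> \<one>) \<otimes> x \<oplus> e \<otimes> y)" using cs cs2 by algebra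
    then have "?D \<otimes> y = \<zero>" using f by (simp add: minus_eq)
    with 1 nz show "?D = \<zero>" by (auto simp: integral_iff)
  next
    assume D: "(a \<ominus> \<one>) \<otimes> (d \<ominus> \<one>) \<ominus> e \<otimes> c = \<zero>"
    \<comment> \<open>A nonzero row (r, s) of the singular matrix M - 1 gives the kernel vector (s,
      -r), up to sign. If both rows vanish, then M = 1 and any vector will do.\<close>
    have "\<exists>x y. (x, y) \<in> vecs \<and> act (a, e, c, d) (x, y) = (x, y)"
    proof (cases "e = \<zero> \<and> a = \<one>")
      case True
      show ?thesis
      proof (cases "c = \<zero> \<and> d = \<one>")
        case True
        with \<open>e = \<zero> \<and> a = \<one>\<close> show ?thesis
          by (intro exI[of _ \<one>] exI[of _ \<zero>]) (simp add: vecs_iff)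
      next
        case False
        have "c \<otimes> (\<one> \<ominus> d) \<oplus> (d \<ominus> \<one>) \<otimes> c = \<zero>" using cs by algebra
        then have "act (a, e, c, d) (\<one> \<ominus> d, c) = (\<one> \<ominus> d, c)"
          using True by (subst fix_iff) (auto simp: minus_eq r_neg)
        moreover have "(\<one> \<ominus> d, c) \<in> vecs"
          using False by (auto simp: vecs_iff)
        ultimately show ?thesis by blast
      qed
    next
      case False
      have "(a \<ominus> \<one>) \<otimes> e \<oplus> e \<otimes> (\<one> \<ominus> a) = \<zero>" using cs by algebra
      moreover have "c \<otimes> e \<oplus> (d \<ominus> \<one>) \<otimes> (\<one> \<ominus> a) = \<ominus> ((a \<ominus> \<one>) \<otimes> (d \<ominus> \<one>) \<ominus> e \<otimes> c)" using cs by algebra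
      ultimately have "act (a, e, c, d) (e, \<one> \<ominus> a) = (e, \<one> \<ominus> a)"
        using D by (subst fix_iff) auto
      moreover have "(e, \<one> \<ominus> a) \<in> vecs"
        using False by (auto simp: vecs_iff)
      ultimately show ?thesis by blast
    qed
    then show "(a, e, c, d) \<in> SL2_fix" using assms unfolding SL2_fix_def by blast
  qed
  with tr show ?thesis by simp
qed

end

section \<open>Counting unipotent elements and eigenvectors over a finite field of odd order\<close>

lemma sum_card_swap:
  assumes "finite A" "finite B"
  shows "(\<Sum>x\<in>A. card {y \<in> B. Q x y}) = (\<Sum>y\<in>B. card {x \<in> A. Q x y})"
  using sum.swap_restrict[OF assms, of "\<lambda>_ _. 1::nat" Q] by simp

lemma sum_of_bool_card:
  "finite A \<Longrightarrow> (\<Sum>x\<in>A. of_bool (Q x)) = of_nat (card {x \<in> A. Q x})"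
  by (simp add: of_bool_def sum.If_cases Int_def)

locale finite_odd_field = field +
  assumes finite_R: "finite (carrier R)" and two_nonzero: "\<one> \<oplus> \<one> \<noteq> \<zero>"
begin

sublocale SL: group "SL2 R" by (rule group_SL2)

abbreviation "q \<equiv> card (carrier R)"

lemma finite_vecs: "finite vecs"
  using finite_R by (simp add: vecs_def)

lemma finite_SL2: "finite (carrier (SL2 R))"
proof (rule finite_subset)
  show "carrier (SL2 R) \<subseteq> carrier R \<times> carrier R \<times> carrier R \<times> carrier R"
    by (auto simp: SL2_def)
qed (simp add: finite_R)

lemma SL2_fix_subset: "SL2_fix \<subseteq> carrier (SL2 R)"
  by (auto simp: SL2_fix_def)

lemma finite_SL2_fix: "finite SL2_fix"
  using SL2_fix_subset finite_SL2 by (rule finite_subset)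

lemma card_vecs: "card vecs = q * q - 1"
proof -
  have "vecs = carrier R \<times> carrier R - {(\<zero>, \<zero>)}" by (simp add: vecs_def)
  then show ?thesis by (simp add: card_Diff_subset card_cartesian_product)
qed

lemma q_gt_1: "q > 1"
proof -
  have "card {\<zero>, \<one>} \<le> q" by (intro card_mono) (auto simp: finite_R)
  then show ?thesis by simp
qed

lemma one_zero_vec: "(\<one>, \<zero>) \<in> vecs"
  by (simp add: vecs_iff)

lemma act_inv_cancel:
  assumes "u \<in> carrier (SL2 R)" "v \<in> carrier R \<times> carrier R"
  shows "act (inv\<^bsub>SL2 R\<^esub> u) (act u v) = v" "act u (act (inv\<^bsub>SL2 R\<^esub> u) v) = v"
  using assms by (simp_all flip: act_mult add: act_one)

lemma act_eq_iff:
  assumes "u \<in> carrier (SL2 R)" "v \<in> carrier R \<times> carrier R" "w \<in> carrier R \<times> carrier R"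
  shows "act (inv\<^bsub>SL2 R\<^esub> u) v = w \<longleftrightarrow> v = act u w"
  using act_inv_cancel[OF assms(1)] assms by metis

text \<open>Transitivity on nonzero vectors reduces the count to the stabiliser of (1, 0), the group
  of upper unitriangular matrices, of order q.\<close>

lemma card_transporter:
  assumes v: "v \<in> vecs" and w: "w \<in> vecs"
  shows "card {u \<in> carrier (SL2 R). act u v = w} = q"
proof -
  obtain m n where m: "m \<in> carrier (SL2 R)" "act m (\<one>, \<zero>) = v"
    and n: "n \<in> carrier (SL2 R)" "act n (\<one>, \<zero>) = w"
    using SL2_transitive[OF v] SL2_transitive[OF w] by auto
  note vw = vecs_carrier[OF v] vecs_carrier[OF w] vecs_carrier[OF one_zero_vec]
  have im: "act (inv\<^bsub>SL2 R\<^esub> m) v = (\<one>, \<zero>)" "act (inv\<^bsub>SL2 R\<^esub> n) w = (\<one>, \<zero>)"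
    using act_inv_cancel(1) m n vw by metis+
  let ?A = "{u \<in> carrier (SL2 R). act u v = w}"
  let ?B = "{u \<in> carrier (SL2 R). act u (\<one>, \<zero>) = (\<one>, \<zero>)}"
  have "bij_betw (\<lambda>u. inv\<^bsub>SL2 R\<^esub> n \<otimes>\<^bsub>SL2 R\<^esub> u \<otimes>\<^bsub>SL2 R\<^esub> m) ?A ?B"
  proof (rule bij_betwI[where g = "\<lambda>u. n \<otimes>\<^bsub>SL2 R\<^esub> u \<otimes>\<^bsub>SL2 R\<^esub> inv\<^bsub>SL2 R\<^esub> m"])
    show "(\<lambda>u. inv\<^bsub>SL2 R\<^esub> n \<otimes>\<^bsub>SL2 R\<^esub> u \<otimes>\<^bsub>SL2 R\<^esub> m) \<in> ?A \<rightarrow> ?B"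
      using m n vw im by (auto simp: act_mult act_closed)
    show "(\<lambda>u. n \<otimes>\<^bsub>SL2 R\<^esub> u \<otimes>\<^bsub>SL2 R\<^esub> inv\<^bsub>SL2 R\<^esub> m) \<in> ?B \<rightarrow> ?A"
      using m n vw im by (auto simp: act_mult act_closed)
  qed (use m n in \<open>simp_all add: SL.m_assoc, simp_all add: SL.m_assoc[symmetric]\<close>)
  then have "card ?A = card ?B" by (rule bij_betw_same_card)
  also have "?B = (\<lambda>e. (\<one>, e, \<zero>, \<one>)) ` carrier R"
    by (auto simp: SL2_carrier_iff minus_eq image_iff)
  also have "card \<dots> = q" by (rule card_image) (auto simp: inj_on_def)
  finally show ?thesis .
qed

lemma card_SL2: "card (carrier (SL2 R)) = (q * q - 1) * q"
proof -
  have "card (carrier (SL2 R)) = (\<Sum>u\<in>carrier (SL2 R). card {w \<in> vecs. act u (\<one>, \<zero>) = w})"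
  proof -
    have "{w \<in> vecs. act u (\<one>, \<zero>) = w} = {act u (\<one>, \<zero>)}" if "u \<in> carrier (SL2 R)" for u
      using act_vecs[OF that one_zero_vec] by auto
    then show ?thesis by simp
  qed
  also have "\<dots> = (\<Sum>w\<in>vecs. card {u \<in> carrier (SL2 R). act u (\<one>, \<zero>) = w})"
    by (rule sum_card_swap[OF finite_SL2 finite_vecs])
  also have "\<dots> = (q * q - 1) * q"
    by (simp add: card_transporter[OF one_zero_vec] card_vecs)
  finally show ?thesis .
qed

lemma SL2_fix_conj:
  assumes "u \<in> SL2_fix" "m \<in> carrier (SL2 R)"
  shows "m \<otimes>\<^bsub>SL2 R\<^esub> u \<otimes>\<^bsub>SL2 R\<^esub> inv\<^bsub>SL2 R\<^esub> m \<in> SL2_fix"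
proof -
  obtain v where v: "v \<in> vecs" "act u v = v" and u: "u \<in> carrier (SL2 R)"
    using assms(1) by (auto simp: SL2_fix_def)
  have "act (m \<otimes>\<^bsub>SL2 R\<^esub> u \<otimes>\<^bsub>SL2 R\<^esub> inv\<^bsub>SL2 R\<^esub> m) (act m v) = act m v"
    using u v assms(2) vecs_carrier[OF v(1)]
    by (simp add: act_mult act_closed act_inv_cancel)
  then show ?thesis using u assms(2) act_vecs[OF assms(2) v(1)] by (auto simp: SL2_fix_def)
qed

lemma SL2_fix_inv: "u \<in> SL2_fix \<Longrightarrow> inv\<^bsub>SL2 R\<^esub> u \<in> SL2_fix"
  unfolding SL2_fix_def using act_eq_iff vecs_carrier by fastforce

lemma one_SL2_fix: "\<one>\<^bsub>SL2 R\<^esub> \<in> SL2_fix"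
  using one_zero_vec act_one[OF vecs_carrier[OF one_zero_vec]] by (auto simp: SL2_fix_def)

text \<open>Conjugation moves v to (1, 0). The first column of u is then prescribed, trace 2 gives
  the other diagonal entry, and the determinant gives the last entry, because independence makes the
  lower left entry nonzero.\<close>

lemma card_fix_transporter_indep:
  assumes v: "v \<in> vecs" and w: "w \<in> vecs" and indep: "det2 v w \<noteq> \<zero>"
  shows "card {u \<in> SL2_fix. act u v = w} = 1"
proof -
  obtain m where m: "m \<in> carrier (SL2 R)" "act m (\<one>, \<zero>) = v"
    using SL2_transitive[OF v] by auto
  let ?m' = "inv\<^bsub>SL2 R\<^esub> m"
  have m': "?m' \<in> carrier (SL2 R)" using m by simp
  define w' where "w' = act ?m' w"
  note vw = vecs_carrier[OF v] vecs_carrier[OF w] vecs_carrier[OF one_zero_vec]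
  have im: "act ?m' v = (\<one>, \<zero>)"
    using act_inv_cancel(1) m vw by metis
  have w': "w' \<in> vecs" "act m w' = w"
    using act_vecs[OF m' w] act_inv_cancel[OF m(1) vw(2)] by (auto simp: w'_def)
  let ?A = "{u \<in> SL2_fix. act u v = w}"
  let ?B = "{u \<in> SL2_fix. act u (\<one>, \<zero>) = w'}"
  have P: "u \<in> carrier (SL2 R)" if "u \<in> SL2_fix" for u using that SL2_fix_subset by auto
  have "bij_betw (\<lambda>u. ?m' \<otimes>\<^bsub>SL2 R\<^esub> u \<otimes>\<^bsub>SL2 R\<^esub> m) ?A ?B"
  proof (rule bij_betwI[where g = "\<lambda>u. m \<otimes>\<^bsub>SL2 R\<^esub> u \<otimes>\<^bsub>SL2 R\<^esub> ?m'"])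
    show "(\<lambda>u. ?m' \<otimes>\<^bsub>SL2 R\<^esub> u \<otimes>\<^bsub>SL2 R\<^esub> m) \<in> ?A \<rightarrow> ?B"
      using m m' vw SL2_fix_conj[OF _ m'] by (auto simp: act_mult act_closed w'_def P)
    show "(\<lambda>u. m \<otimes>\<^bsub>SL2 R\<^esub> u \<otimes>\<^bsub>SL2 R\<^esub> ?m') \<in> ?B \<rightarrow> ?A"
      using m m' vw w' im SL2_fix_conj[OF _ m(1)] by (auto simp: act_mult act_closed P)
  qed (use m P in \<open>simp_all add: SL.m_assoc, simp_all add: SL.m_assoc[symmetric]\<close>)
  then have "card ?A = card ?B" by (rule bij_betw_same_card)
  also have "card ?B = 1"
  proof -
    obtain x y where xy: "w' = (x, y)" by (cases w')
    have cs [simp]: "x \<in> carrier R" "y \<in> carrier R" using w' by (auto simp: xy vecs_iff)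
    have "det2 (\<one>, \<zero>) w' \<noteq> \<zero>"
      using det2_act[OF m' vw(1,2)] indep by (simp add: im w'_def)
    then have y: "y \<noteq> \<zero>" by (auto simp: xy minus_eq)
    then have uy: "y \<in> Units R" by (simp add: field_Units)
    then have iy [simp]: "inv y \<in> carrier R" and yi: "inv y \<otimes> y = \<one>" by simp_all
    define d where "d = \<one> \<oplus> \<one> \<ominus> x"
    define e where "e = (x \<otimes> d \<ominus> \<one>) \<otimes> inv y"
    have d [simp]: "d \<in> carrier R" and e [simp]: "e \<in> carrier R" by (simp_all add: d_def e_def)
    have ey: "e \<otimes> y = x \<otimes> d \<ominus> \<one>" using uy by (simp add: e_def m_assoc)
    have "?B = {(x, e, y, d)}"
    proof (intro equalityI subsetI)
      fix u assume u: "u \<in> ?B"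
      obtain a e' c d' where u': "u = (a, e', c, d')" by (cases u)
      have uS: "(a, e', c, d') \<in> carrier (SL2 R)" using u P by (auto simp: u')
      then have cs' [simp]: "a \<in> carrier R" "e' \<in> carrier R" "c \<in> carrier R" "d' \<in> carrier R"
        and det: "a \<otimes> d' \<ominus> e' \<otimes> c = \<one>" by (auto simp: SL2_carrier_iff)
      have ac: "a = x" "c = y" using u by (auto simp: u' xy)
      have "a \<oplus> d' = \<one> \<oplus> \<one>" using u SL2_fix_iff_trace[OF uS] by (simp add: u')
      moreover have "d' = (a \<oplus> d') \<ominus> a" using cs' by algebra
      ultimately have d': "d' = d" by (simp add: d_def ac)
      have "e' \<otimes> y = x \<otimes> d \<ominus> (x \<otimes> d \<ominus> e' \<otimes> y)" using cs cs' d by algebra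
      also have "\<dots> = e \<otimes> y" using det by (simp add: ey ac d')
      finally have "e' = e" using y by (simp add: m_rcancel)
      then show "u \<in> {(x, e, y, d)}" by (simp add: u' ac d')
    next
      fix u assume "u \<in> {(x, e, y, d)}"
      then have u: "u = (x, e, y, d)" by simp
      have "x \<otimes> d \<ominus> (x \<otimes> d \<ominus> \<one>) = \<one>" using cs d by algebra
      then have uS: "(x, e, y, d) \<in> carrier (SL2 R)" by (simp add: SL2_carrier_iff ey)
      have "x \<oplus> d = \<one> \<oplus> \<one>" unfolding d_def using cs by algebra
      then show "u \<in> ?B" using SL2_fix_iff_trace[OF uS] by (simp add: u xy)
    qed
    then show ?thesis by simp
  qed
  finally show ?thesis .
qed

text \<open>The only eigenvalue of a unipotent element is 1. With v0 fixed by u and u v = r v,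
  either v is a multiple of v0, or invariance of the form gives det2(v0, v) = r det2(v0, v) with a
  nonzero determinant.\<close>

lemma fix_transporter_dep:
  assumes v: "v \<in> vecs" and w: "w \<in> vecs" and dep: "det2 v w = \<zero>" and u: "u \<in> SL2_fix" "act u v = w"
  shows "w = v"
proof -
  obtain v0 where v0: "v0 \<in> vecs" "act u v0 = v0" and uS: "u \<in> carrier (SL2 R)"
    using u(1) by (auto simp: SL2_fix_def)
  obtain r where r: "r \<in> carrier R" "w = scale2 r v"
    using det2_zero_imp_scale2[OF v w dep] by auto
  note c = vecs_carrier[OF v] vecs_carrier[OF v0(1)]
  have [simp]: "scale2 \<one> v = v" using c by (cases v) auto
  show ?thesis
  proof (cases "det2 v0 v = \<zero>")
    case True
    then obtain s where "s \<in> carrier R" "v = scale2 s v0"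
      using det2_zero_imp_scale2[OF v0(1) v] by auto
    then show ?thesis using act_scale2[OF uS c(2)] v0(2) u(2) by simp
  next
    case False
    have cl: "det2 v0 v \<in> carrier R" using c by (intro det2_closed)
    have "det2 v0 v = det2 (act u v0) (act u v)" using det2_act[OF uS c(2,1)] by simp
    also have "\<dots> = r \<otimes> det2 v0 v"
      using u(2) v0(2) r det2_scale2_right[OF c(2,1) r(1)] by simp
    finally have "\<one> \<otimes> det2 v0 v = r \<otimes> det2 v0 v" using cl by simp
    then have "r = \<one>" using m_rcancel[of "det2 v0 v" \<one> r] False cl r(1) by auto
    then show ?thesis using r by simp
  qed
qed

lemma line_eq:
  assumes v: "v \<in> vecs"
  shows "{w \<in> vecs. det2 v w = \<zero>} = (\<lambda>r. scale2 r v) ` (carrier R - {\<zero>})"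
proof -
  have "det2 v (scale2 r v) = \<zero>" if "r \<in> carrier R" for r
    using det2_scale2_right[of v v r] det2_self[of v] vecs_carrier[OF v] that by simp
  then show ?thesis using det2_zero_imp_scale2[OF v] scale2_vecs[OF v] by blast
qed

lemma inj_scale2: "v \<in> vecs \<Longrightarrow> inj_on (\<lambda>r. scale2 r v) (carrier R - {\<zero>})"
  by (auto simp: inj_on_def scale2_eq_iff)

lemma card_line: "v \<in> vecs \<Longrightarrow> card {w \<in> vecs. det2 v w = \<zero>} = q - 1"
  unfolding line_eq by (simp add: card_image[OF inj_scale2] card_Diff_singleton)

text \<open>Two independent fixed vectors would force u = 1, so the fixed vectors are the nonzero
  points of a single line.\<close>

lemma card_fixed_vecs:
  assumes u: "u \<in> SL2_fix" "u \<noteq> \<one>\<^bsub>SL2 R\<^esub>"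
  shows "card {v \<in> vecs. act u v = v} = q - 1"
proof -
  obtain v0 where v0: "v0 \<in> vecs" "act u v0 = v0" and uS: "u \<in> carrier (SL2 R)"
    using u(1) by (auto simp: SL2_fix_def)
  have "{v \<in> vecs. act u v = v} = {v \<in> vecs. det2 v0 v = \<zero>}"
  proof (intro Collect_cong conj_cong refl iffI)
    fix v assume v: "v \<in> vecs" "act u v = v"
    show "det2 v0 v = \<zero>"
    proof (rule ccontr)
      assume indep: "det2 v0 v \<noteq> \<zero>"
      obtain a e c d where u': "u = (a, e, c, d)" by (cases u)
      obtain x y z w where vs: "v0 = (x, y)" "v = (z, w)" by (cases v0; cases v) auto
      have cs [simp]: "a \<in> carrier R" "e \<in> carrier R" "c \<in> carrier R" "d \<in> carrier R"
        "x \<in> carrier R" "y \<in> carrier R" "z \<in> carrier R" "w \<in> carrier R"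
        using uS v0 v by (auto simp: u' vs SL2_carrier_iff vecs_iff)
      have eqs: "a \<otimes> x \<oplus> e \<otimes> y = x" "c \<otimes> x \<oplus> d \<otimes> y = y" "a \<otimes> z \<oplus> e \<otimes> w = z" "c \<otimes> z \<oplus> d \<otimes> w = w"
        using v0 v by (auto simp: u' vs)
      let ?D = "x \<otimes> w \<ominus> y \<otimes> z"
      have D: "?D \<in> carrier R" "?D \<noteq> \<zero>" using indep by (simp_all add: vs)
      \<comment> \<open>Cramer's rule recovers the entries of u from its action on the two
        independent vectors.\<close>
      have "a \<otimes> ?D = (a \<otimes> x \<oplus> e \<otimes> y) \<otimes> w \<ominus> (a \<otimes> z \<oplus> e \<otimes> w) \<otimes> y" using cs by algebra
      also have "\<dots> = \<one> \<otimes> ?D" unfolding eqs using cs by algebra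
      finally have "a = \<one>" using D m_rcancel[of ?D a \<one>] by simp
      have "d \<otimes> ?D = (c \<otimes> z \<oplus> d \<otimes> w) \<otimes> x \<ominus> (c \<otimes> x \<oplus> d \<otimes> y) \<otimes> z" using cs by algebra
      also have "\<dots> = \<one> \<otimes> ?D" unfolding eqs using cs by algebra
      finally have "d = \<one>" using D m_rcancel[of ?D d \<one>] by simp
      have "e \<otimes> ?D = (a \<otimes> z \<oplus> e \<otimes> w) \<otimes> x \<ominus> (a \<otimes> x \<oplus> e \<otimes> y) \<otimes> z" using cs by algebra
      also have "\<dots> = \<zero> \<otimes> ?D" unfolding eqs using cs by algebra
      finally have "e = \<zero>" using D m_rcancel[of ?D e \<zero>] by simp
      have "c \<otimes> ?D = (c \<otimes> x \<oplus> d \<otimes> y) \<otimes> w \<ominus> (c \<otimes> z \<oplus> d \<otimes> w) \<otimes> y" using cs by algebra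
      also have "\<dots> = \<zero> \<otimes> ?D" unfolding eqs using cs by algebra
      finally have "c = \<zero>" using D m_rcancel[of ?D c \<zero>] by simp
      show False using u(2) \<open>a = \<one>\<close> \<open>e = \<zero>\<close> \<open>c = \<zero>\<close> \<open>d = \<one>\<close> by (simp add: u' SL2_one)
    qed
  next
    fix v assume v: "v \<in> vecs" "det2 v0 v = \<zero>"
    then obtain r where "r \<in> carrier R" "v = scale2 r v0"
      using det2_zero_imp_scale2[OF v0(1) v] by blast
    then show "act u v = v" using act_scale2[OF uS vecs_carrier[OF v0(1)]] v0(2) by simp
  qed
  then show ?thesis using card_line[OF v0(1)] by simp
qed

text \<open>The condition says that v is an eigenvector of x with eigenvalue in the field.\<close>

definition eigenvecs :: "'a \<times> 'a \<times> 'a \<times> 'a \<Rightarrow> nat" where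
  "eigenvecs x = card {v \<in> vecs. det2 v (act x v) = \<zero>}"

text \<open>The value at x of the convolution square of the indicator function of
  \<open>SL2_fix\<close>.\<close>

definition fix_factorizations :: "'a \<times> 'a \<times> 'a \<times> 'a \<Rightarrow> nat" where
  "fix_factorizations x = card {a \<in> SL2_fix. inv\<^bsub>SL2 R\<^esub> a \<otimes>\<^bsub>SL2 R\<^esub> x \<in> SL2_fix}"

text \<open>The identity fixes q^2 - 1 = (q - 1) + q(q - 1) nonzero vectors. A combination of
  indicator functions is the form that can be summed over translates of x.\<close>

lemma card_fixed_vecs_eq:
  assumes x: "x \<in> carrier (SL2 R)"
  shows "real (card {v \<in> vecs. act x v = v}) =
    (real q - 1) * of_bool (x \<in> SL2_fix) + real q * (real q - 1) * of_bool (x = \<one>\<^bsub>SL2 R\<^esub>)"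
proof (cases "x = \<one>\<^bsub>SL2 R\<^esub>")
  case True
  then have "{v \<in> vecs. act x v = v} = vecs" using act_one vecs_carrier by auto
  then show ?thesis using True one_SL2_fix q_gt_1 
    by (simp add: card_vecs of_nat_diff algebra_simps Suc_le_eq)
next
  case False
  show ?thesis
  proof (cases "x \<in> SL2_fix")
    case True
    then show ?thesis using False q_gt_1 by (simp add: card_fixed_vecs of_nat_diff)
  next
    case nf: False
    then have e: "{v \<in> vecs. act x v = v} = {}" using x by (auto simp: SL2_fix_def)
    show ?thesis unfolding e using nf False by simp
  qed
qed

lemma sum_of_bool_eigenvecs:
  "(\<Sum>v\<in>vecs. of_bool (det2 v (act x v) \<noteq> \<zero>)) = real q * real q - 1 - real (eigenvecs x)"
proof -
  have "(\<Sum>v\<in>vecs. of_bool (det2 v (act x v) \<noteq> \<zero>)) = (\<Sum>v\<in>vecs. 1 - of_bool (det2 v (act x v) = \<zero>) :: real)"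
    by (intro sum.cong refl) simp
  also have "\<dots> = real (card vecs) - (\<Sum>v\<in>vecs. of_bool (det2 v (act x v) = \<zero>))"
    by (simp add: sum_subtractf)
  also have "(\<Sum>v\<in>vecs. of_bool (det2 v (act x v) = \<zero>) :: real) = eigenvecs x"
    by (simp add: eigenvecs_def finite_vecs of_bool_def Int_def sum.If_cases)
  finally show ?thesis using q_gt_1 by (simp add: card_vecs of_nat_diff Suc_le_eq)
qed

text \<open>Both sides come from counting the pairs (a, v) with a in SL2_fix and a v = x v.\<close>

lemma fix_factorizations_eq:
  assumes x: "x \<in> carrier (SL2 R)"
  shows "(real q - 1) * fix_factorizations x =
    (real q)\<^sup>2 * (real q - 1) * of_bool (x = \<one>\<^bsub>SL2 R\<^esub>) + (real q)\<^sup>2 - 1 - eigenvecs x"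
proof -
  let ?P = "SL2_fix" and ?i = "\<lambda>a. inv\<^bsub>SL2 R\<^esub> a \<otimes>\<^bsub>SL2 R\<^esub> x"
  have PS: "a \<in> carrier (SL2 R)" if "a \<in> ?P" for a using that SL2_fix_subset by auto
  have "(\<Sum>a\<in>?P. card {v \<in> vecs. act (?i a) v = v}) = (\<Sum>a\<in>?P. card {v \<in> vecs. act a v = act x v})"
  proof (intro sum.cong refl arg_cong[where f = card] Collect_cong conj_cong)
    fix a v assume "a \<in> ?P" "v \<in> vecs"
    then show "act (?i a) v = v \<longleftrightarrow> act a v = act x v"
      using x by (subst act_mult) (auto simp: PS vecs_carrier act_eq_iff act_closed)
  qed
  also have "\<dots> = (\<Sum>v\<in>vecs. card {a \<in> ?P. act a v = act x v})"
    by (rule sum_card_swap[OF finite_SL2_fix finite_vecs])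
  finally have eq: "(\<Sum>a\<in>?P. real (card {v \<in> vecs. act (?i a) v = v})) = (\<Sum>v\<in>vecs. real (card {a \<in> ?P. act a v = act x v}))"
    by (simp flip: of_nat_sum)
  have "(\<Sum>v\<in>vecs. real (card {a \<in> ?P. act a v = act x v})) =
    (\<Sum>v\<in>vecs. real q * of_bool (act x v = v) + of_bool (det2 v (act x v) \<noteq> \<zero>))"
  proof (intro sum.cong refl)
    fix v assume v: "v \<in> vecs"
    have xv: "act x v \<in> vecs" using act_vecs[OF x v] .
    have z: "det2 v v = \<zero>" using v by (simp add: det2_self vecs_carrier)
    \<comment> \<open>In the first case the whole stabiliser of v qualifies, as it consists of
      unipotent elements. In the second case no unipotent element does, and in the third case
      exactly one.\<close>
    consider "act x v = v" | "act x v \<noteq> v" "det2 v (act x v) = \<zero>" | "det2 v (act x v) \<noteq> \<zero>"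
      by blast
    then show "real (card {a \<in> ?P. act a v = act x v}) = real q * of_bool (act x v = v) + of_bool (det2 v (act x v) \<noteq> \<zero>)"
    proof cases
      case 1
      have "{a \<in> ?P. act a v = v} = {a \<in> carrier (SL2 R). act a v = v}"
        using v by (auto simp: SL2_fix_def)
      then show ?thesis using 1 card_transporter[OF v v] z by simp
    next
      case 2
      then have e: "{a \<in> ?P. act a v = act x v} = {}" using fix_transporter_dep[OF v xv] by auto
      show ?thesis unfolding e using 2 by simp
    next
      case 3
      then show ?thesis using card_fix_transporter_indep[OF v xv] z by auto
    qed
  qed
  also have "\<dots> = real q * real (card {v \<in> vecs. act x v = v}) + (real q * real q - 1 - real (eigenvecs x))"
    unfolding sum.distrib sum_of_bool_eigenvecs sum_distrib_left[symmetric] sum_of_bool_card[OF finite_vecs] ..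
  finally have R: "(\<Sum>v\<in>vecs. real (card {a \<in> ?P. act a v = act x v})) =
    real q * ((real q - 1) * of_bool (x \<in> SL2_fix) + real q * (real q - 1) * of_bool (x = \<one>\<^bsub>SL2 R\<^esub>)) + (real q * real q - 1 - real (eigenvecs x))"
    unfolding card_fixed_vecs_eq[OF x] .
  have "(\<Sum>a\<in>?P. real (card {v \<in> vecs. act (?i a) v = v})) =
    (\<Sum>a\<in>?P. (real q - 1) * of_bool (?i a \<in> ?P) + real q * (real q - 1) * of_bool (a = x))"
  proof (intro sum.cong refl)
    fix a assume a: "a \<in> ?P"
    have "?i a = \<one>\<^bsub>SL2 R\<^esub> \<longleftrightarrow> a = x"
      using PS[OF a] x by (metis SL.inv_solve_left' SL.l_inv SL.one_closed SL.r_one)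
    then show "real (card {v \<in> vecs. act (?i a) v = v}) = (real q - 1) * of_bool (?i a \<in> ?P) + real q * (real q - 1) * of_bool (a = x)"
      using PS[OF a] x by (subst card_fixed_vecs_eq) auto
  qed
  also have "\<dots> = (real q - 1) * fix_factorizations x + real q * (real q - 1) * of_bool (x \<in> ?P)"
    by (simp add: sum.distrib sum_distrib_left[symmetric] fix_factorizations_def finite_SL2_fix of_bool_def Int_def sum.If_cases)
  \<comment> \<open>Both counts contain the term q(q - 1) for x in \<open>SL2_fix\<close>, which
    cancels.\<close>
  finally show ?thesis using R eq by (simp add: algebra_simps power2_eq_square)
qed

text \<open>The factorization count is evaluated at the identity: there the factorizations are all
  pairs (a, a^-1), and every nonzero vector is an eigenvector.\<close>

lemma card_SL2_fix: "card SL2_fix = q\<^sup>2"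
proof -
  have "{a \<in> SL2_fix. inv\<^bsub>SL2 R\<^esub> a \<otimes>\<^bsub>SL2 R\<^esub> \<one>\<^bsub>SL2 R\<^esub> \<in> SL2_fix} = SL2_fix"
    using SL2_fix_inv SL2_fix_subset by auto
  then have 1: "fix_factorizations \<one>\<^bsub>SL2 R\<^esub> = card SL2_fix" by (simp add: fix_factorizations_def)
  have "{v \<in> vecs. det2 v (act \<one>\<^bsub>SL2 R\<^esub> v) = \<zero>} = vecs"
    using act_one vecs_carrier det2_self by auto
  then have 2: "real (eigenvecs \<one>\<^bsub>SL2 R\<^esub>) = (real q)\<^sup>2 - 1"
    using q_gt_1 by (simp add: eigenvecs_def card_vecs of_nat_diff Suc_le_eq power2_eq_square)
  have "(real q - 1) * real (card SL2_fix) = (real q - 1) * (real q)\<^sup>2"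
    using fix_factorizations_eq[OF SL.one_closed] unfolding 1 2 by simp
  then have "real (card SL2_fix) = (real q)\<^sup>2" using q_gt_1 by simp
  then show ?thesis by (metis of_nat_eq_iff of_nat_power)
qed

text \<open>For each v one counts the unipotent z that send v into the line of x v. If this is the
  line of v, only v itself is reached, by q elements; otherwise each of the q - 1 vectors of the
  line is reached once. Divided by q - 1, the identity says that the permutation character minus 1,
  the Steinberg character, is an eigenfunction with eigenvalue 1.\<close>

lemma sum_eigenvecs_translate:
  assumes x: "x \<in> carrier (SL2 R)"
  shows "(\<Sum>z\<in>SL2_fix. real (eigenvecs (inv\<^bsub>SL2 R\<^esub> z \<otimes>\<^bsub>SL2 R\<^esub> x))) = (real q - 1) * ((real q)\<^sup>2 - 1) + eigenvecs x"
proof -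
  let ?P = "SL2_fix" and ?i = "\<lambda>a. inv\<^bsub>SL2 R\<^esub> a \<otimes>\<^bsub>SL2 R\<^esub> x"
  have PS: "a \<in> carrier (SL2 R)" if "a \<in> ?P" for a using that SL2_fix_subset by auto
  have "(\<Sum>z\<in>?P. eigenvecs (?i z)) = (\<Sum>z\<in>?P. card {v \<in> vecs. det2 (act x v) (act z v) = \<zero>})"
    unfolding eigenvecs_def
  proof (intro sum.cong refl arg_cong[where f = card] Collect_cong conj_cong)
    fix z v assume z: "z \<in> ?P" and v: "v \<in> vecs"
    note c = vecs_carrier[OF v] act_closed[OF x vecs_carrier[OF v]] PS[OF z] act_closed[OF PS[OF z] vecs_carrier[OF v]]
    have "det2 v (act (?i z) v) = det2 (act z v) (act z (act (?i z) v))"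
      using c x by (intro det2_act[symmetric] act_closed) auto
    also have "act z (act (?i z) v) = act x v"
      using c x by (simp add: act_mult act_inv_cancel)
    finally show "det2 v (act (?i z) v) = \<zero> \<longleftrightarrow> det2 (act x v) (act z v) = \<zero>"
      using det2_zero_swap c by simp
  qed
  also have "\<dots> = (\<Sum>v\<in>vecs. card {z \<in> ?P. det2 (act x v) (act z v) = \<zero>})"
    by (rule sum_card_swap[OF finite_SL2_fix finite_vecs])
  finally have "(\<Sum>z\<in>?P. real (eigenvecs (?i z))) = (\<Sum>v\<in>vecs. real (card {z \<in> ?P. det2 (act x v) (act z v) = \<zero>}))"
    by (simp flip: of_nat_sum)
  also have "\<dots> = (\<Sum>v\<in>vecs. real q - of_bool (det2 v (act x v) \<noteq> \<zero>))"
  proof (intro sum.cong refl)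
    fix v assume v: "v \<in> vecs"
    define w where "w = act x v"
    have w: "w \<in> vecs" using act_vecs[OF x v] by (simp add: w_def)
    let ?L = "{w' \<in> vecs. det2 w w' = \<zero>}"
    have "act z v \<in> vecs" if "z \<in> ?P" for z using act_vecs[OF PS[OF that] v] .
    then have "{z \<in> ?P. det2 w (act z v) = \<zero>} = (\<Union>w'\<in>?L. {z \<in> ?P. act z v = w'})"
      by blast
    then have "card {z \<in> ?P. det2 w (act z v) = \<zero>} = (\<Sum>w'\<in>?L. card {z \<in> ?P. act z v = w'})"
      by (simp only:, subst card_UN_disjoint) (use finite_vecs finite_SL2_fix in auto)
    also have "real \<dots> = real q - of_bool (det2 v w \<noteq> \<zero>)"
    proof (cases "det2 v w = \<zero>")
      case True
      have L: "?L = {w' \<in> vecs. det2 v w' = \<zero>}"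
      proof -
        obtain r where r: "r \<in> carrier R - {\<zero>}" "w = scale2 r v"
          using det2_zero_imp_scale2[OF v w True] by auto
        have "det2 w w' = \<zero> \<longleftrightarrow> det2 v w' = \<zero>" if "w' \<in> vecs" for w'
        proof -
          have "det2 w w' = \<zero> \<longleftrightarrow> r \<otimes> det2 w' v = \<zero>"
            using det2_zero_swap[of w w'] r det2_scale2_right[of w' v r] vecs_carrier that v w by auto
          also have "\<dots> \<longleftrightarrow> det2 v w' = \<zero>"
            using r integral_iff[of r "det2 w' v"] det2_zero_swap[of v w'] det2_closed[of w' v] vecs_carrier that v by auto
          finally show ?thesis .
        qed
        then show ?thesis by auto
      qed
      have vL: "v \<in> ?L" unfolding L using v det2_self[OF vecs_carrier] by auto
      have "(\<Sum>w'\<in>?L. card {z \<in> ?P. act z v = w'}) = (\<Sum>w'\<in>?L. if w' = v then q else 0)"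
      proof (intro sum.cong refl)
        fix w' assume w': "w' \<in> ?L"
        show "card {z \<in> ?P. act z v = w'} = (if w' = v then q else 0)"
        proof (cases "w' = v")
          case True
          have "{a \<in> ?P. act a v = v} = {a \<in> carrier (SL2 R). act a v = v}"
            using v by (auto simp: SL2_fix_def)
          then show ?thesis using True card_transporter[OF v v] by simp
        next
          case False
          then have e: "{z \<in> ?P. act z v = w'} = {}" using fix_transporter_dep[OF v, of w'] w' unfolding L by auto
          show ?thesis unfolding e using False by simp
        qed
      qed
      also have "\<dots> = q" using vL finite_vecs by simp
      finally show ?thesis using True by simp
    next
      case False
      have "card {z \<in> ?P. act z v = w'} = 1" if w': "w' \<in> ?L" for w'
      proof -
        obtain r where r: "r \<in> carrier R - {\<zero>}" "w' = scale2 r w"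
          using det2_zero_imp_scale2[OF w, of w'] w' by auto
        have "det2 v w' \<noteq> \<zero>"
          using r False det2_scale2_right[of v w r] integral_iff[of r "det2 v w"] det2_closed[of v w] vecs_carrier v w
          by auto
        then show ?thesis using card_fix_transporter_indep[OF v] w' by auto
      qed
      then have "(\<Sum>w'\<in>?L. card {z \<in> ?P. act z v = w'}) = q - 1"
        using card_line[OF w] by simp
      then show ?thesis using False q_gt_1 by (simp add: of_nat_diff)
    qed
    finally show "real (card {z \<in> ?P. det2 (act x v) (act z v) = \<zero>}) = real q - of_bool (det2 v (act x v) \<noteq> \<zero>)"
      by (simp add: w_def)
  qed
  also have "\<dots> = real q * real (card vecs) - (real q * real q - 1 - real (eigenvecs x))"
    by (simp add: sum_subtractf sum_of_bool_eigenvecs)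
  also have "\<dots> = (real q - 1) * ((real q)\<^sup>2 - 1) + eigenvecs x"
    using q_gt_1 by (simp add: card_vecs of_nat_diff Suc_le_eq algebra_simps power2_eq_square)
  finally show ?thesis .
qed

end

section \<open>Convolution eigenfunctions on PSL2\<close>

text \<open>Here f is the permutation character on the projective line, so 1/n and e1 are the central
  idempotents of the trivial and Steinberg characters; on the complement u of both, convolution
  with P squares to q^2.\<close>

lemma (in group) spectral_family_of_point_count:
  fixes P :: "'a set" and f :: "'a \<Rightarrow> real" and q :: real
  assumes fin: "finite (carrier G)" and P: "P \<subseteq> carrier G" and P_inv: "\<And>z. z \<in> P \<Longrightarrow> inv z \<in> P"
    and one: "\<one> \<in> P" and q: "q \<ge> 5"
    and card_G: "real (card (carrier G)) = q * (q\<^sup>2 - 1) / 2" and card_P: "real (card P) = q\<^sup>2"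
    and f1: "f \<one> = q + 1"
    and Tf: "\<And>y. y \<in> carrier G \<Longrightarrow> (\<Sum>z\<in>P. f (inv z \<otimes> y)) = f y + q\<^sup>2 - 1"
    and TP: "\<And>y. y \<in> carrier G \<Longrightarrow>
      (\<Sum>z\<in>P. of_bool (inv z \<otimes> y \<in> P)) = q\<^sup>2 * of_bool (y = \<one>) + 2 * (q + 1) - 2 * f y"
  shows "\<exists>A \<epsilon>. spectral_family G P A \<epsilon> \<and> (\<forall>a\<in>A. \<epsilon> a \<one> \<le> 1 / 2)"
proof -
  \<comment> \<open>\<open>n\<close> is the group order, and \<open>e1\<close> is q(f - 1)/n: degree
    times character over order for the Steinberg character f - 1 of degree q.\<close>
  define n where "n = q * (q\<^sup>2 - 1) / 2"
  define e1 where "e1 y = 2 * (f y - 1) / (q\<^sup>2 - 1)" for y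
  define u where "u y = of_bool (y = \<one>) - 1 / n - e1 y" for y
  \<comment> \<open>\<open>u'\<close> is the convolution of \<open>P\<close> with \<open>u\<close>.
    As convolving twice multiplies \<open>u\<close> by q^2, the functions (u + u'/q)/2 and (u -
    u'/q)/2 are eigenfunctions for q and -q.\<close>
  define u' where "u' y = of_bool (y \<in> P) - q\<^sup>2 / n - e1 y" for y
  define \<epsilon> where "\<epsilon> a y = (if a = q\<^sup>2 then 1 / n else if a = 1 then e1 y
    else if a = q then (u y + u' y / q) / 2 else (u y - u' y / q) / 2)" for a y
  define A where "A = {q\<^sup>2, 1, q, -q}"
  have q2: "q\<^sup>2 \<ge> 5 * q" using q by (simp add: power2_eq_square)
  have dist: "q\<^sup>2 \<noteq> 1" "q\<^sup>2 \<noteq> q" "q\<^sup>2 \<noteq> -q" "1 \<noteq> q" "1 \<noteq> -q" "q \<noteq> -q" "q \<noteq> 0"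
    using q q2 by auto
  have finP: "finite P" using P fin by (rule finite_subset)
  have Te1: "(\<Sum>z\<in>P. e1 (inv z \<otimes> y)) = e1 y" if y: "y \<in> carrier G" for y
  proof -
    have "(\<Sum>z\<in>P. e1 (inv z \<otimes> y)) = 2 * ((\<Sum>z\<in>P. f (inv z \<otimes> y)) - real (card P)) / (q\<^sup>2 - 1)"
      by (simp add: e1_def sum_divide_distrib[symmetric] sum_distrib_left[symmetric] sum_subtractf)
    also have "\<dots> = e1 y" by (simp add: Tf[OF y] card_P e1_def)
    finally show ?thesis .
  qed
  have T\<delta>: "(\<Sum>z\<in>P. of_bool (inv z \<otimes> y = \<one>)) = (of_bool (y \<in> P) :: real)" if y: "y \<in> carrier G" for y
  proof -
    have "inv z \<otimes> y = \<one> \<longleftrightarrow> z = y" if "z \<in> P" for z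
      using that P y by (metis inv_closed inv_equality inv_inv l_inv subsetD)
    then have "(\<Sum>z\<in>P. of_bool (inv z \<otimes> y = \<one>)) = (\<Sum>z\<in>P. if z = y then 1 else 0 :: real)"
      by (intro sum.cong) auto
    then show ?thesis using finP by simp
  qed
  have Tu: "(\<Sum>z\<in>P. u (inv z \<otimes> y)) = u' y" if y: "y \<in> carrier G" for y
    by (simp add: u_def u'_def sum_subtractf Te1[OF y] T\<delta>[OF y] card_P)
  have Tu': "(\<Sum>z\<in>P. u' (inv z \<otimes> y)) = q\<^sup>2 * u y" if y: "y \<in> carrier G" for y
  proof -
    define s where "s = q\<^sup>2 - 1"
    have s: "s \<noteq> 0" "q\<^sup>2 = s + 1" using dist by (auto simp: s_def)
    have n: "n = q * s / 2" by (simp add: n_def s_def)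
    have a: "q\<^sup>2 / n = 2 * q / s" "1 / n = 2 / (q * s)"
      using dist s(1) by (auto simp: n field_simps power2_eq_square)
    have "(\<Sum>z\<in>P. u' (inv z \<otimes> y)) = q\<^sup>2 * of_bool (y = \<one>) + 2 * (q + 1) - 2 * f y - q\<^sup>2 * (q\<^sup>2 / n) - e1 y"
      by (simp add: u'_def sum_subtractf Te1[OF y] TP[OF y] card_P)
    \<comment> \<open>Here 2(f - 1) = (q^2 - 1) e1 removes f, and the remaining constant 2q equals
      (q^2 - 1) q^2/n.\<close>
    moreover have "2 * (q + 1) - 2 * f y - q\<^sup>2 * (q\<^sup>2 / n) - e1 y = - (q\<^sup>2 / n) - q\<^sup>2 * e1 y"
    proof -
      have "q\<^sup>2 * (q\<^sup>2 / n) - q\<^sup>2 / n = 2 * q"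
        unfolding a(1) using s by (simp add: field_simps)
      moreover have "q\<^sup>2 * e1 y - e1 y = 2 * (f y - 1)"
        using s by (simp add: e1_def field_simps)
      ultimately show ?thesis by simp
    qed
    ultimately show ?thesis by (simp add: u_def algebra_simps)
  qed
  have "spectral_family G P A \<epsilon>"
  proof (intro spectral_family.intro spectral_family_axioms.intro)
    show "0 \<notin> A" "finite A" using dist by (auto simp: A_def)
    show "(\<Sum>a\<in>A. \<epsilon> a x) = (if x = \<one> then 1 else 0)" for x
      using dist by (simp add: A_def \<epsilon>_def u_def field_simps)
    fix a y assume a: "a \<in> A" and y: "y \<in> carrier G"
    consider "a = q\<^sup>2" | "a = 1" | "a = q" | "a = -q" using a by (auto simp: A_def)
    then show "(\<Sum>z\<in>P. \<epsilon> a (inv z \<otimes> y)) = a * \<epsilon> a y"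
    proof cases
      case 1
      then show ?thesis by (simp add: \<epsilon>_def card_P)
    next
      case 2
      then show ?thesis using dist by (simp add: \<epsilon>_def Te1[OF y])
    next
      case 3
      then have "(\<Sum>z\<in>P. \<epsilon> a (inv z \<otimes> y)) = (u' y + q\<^sup>2 * u y / q) / 2"
        using dist by (simp add: \<epsilon>_def sum_divide_distrib[symmetric] sum.distrib Tu[OF y] Tu'[OF y])
      also have "\<dots> = a * \<epsilon> a y" using 3 dist by (simp add: \<epsilon>_def field_simps power2_eq_square)
      finally show ?thesis .
    next
      case 4
      then have "(\<Sum>z\<in>P. \<epsilon> a (inv z \<otimes> y)) = (u' y - q\<^sup>2 * u y / q) / 2"
        using dist by (simp add: \<epsilon>_def sum_divide_distrib[symmetric] sum_subtractf Tu[OF y] Tu'[OF y])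
      also have "\<dots> = a * \<epsilon> a y" using 4 dist by (simp add: \<epsilon>_def field_simps power2_eq_square)
      finally show ?thesis .
    qed
  qed (use assms in auto)
  moreover have "\<epsilon> a \<one> \<le> 1 / 2" if "a \<in> A" for a
  proof -
    \<comment> \<open>\<open>t\<close> is the mass of the Steinberg part and also |P|/n. From q
      \<ge> 5 one gets t \<le> 1/2, so that 0 \<le> u'(1)/q \<le> 1/q \<le> t; the mass t already
      removed from u(1) absorbs this correction.\<close>
    define t where "t = 2 * q / (q\<^sup>2 - 1)"
    have s: "q\<^sup>2 - 1 \<ge> 4 * q" "q\<^sup>2 - 1 > 0" using q2 q by auto
    have t: "0 \<le> t" "t \<le> 1 / 2" "1 / q \<le> t"
      using s q by (auto simp: t_def divide_simps power2_eq_square)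
    have e: "e1 \<one> = t" by (simp add: e1_def f1 t_def)
    have n: "0 \<le> 1 / n" "1 / n \<le> 1 / 2" "q\<^sup>2 / n = t"
    proof -
      have "1 * 4 \<le> q * (q\<^sup>2 - 1)" using q s by (intro mult_mono) auto
      then have "n \<ge> 2" by (simp add: n_def)
      then show "0 \<le> 1 / n" "1 / n \<le> 1 / 2" by (auto simp: divide_simps)
      show "q\<^sup>2 / n = t" using q s(2) by (simp add: n_def t_def divide_simps power2_eq_square)
    qed
    have u: "u \<one> \<le> 1 - t" using n by (simp add: u_def e)
    have u': "u' \<one> = 1 - 2 * t" using one n(3) by (simp add: u'_def e)
    have d: "0 \<le> u' \<one> / q" "u' \<one> / q \<le> 1 / q"
      unfolding u' using t q by (auto intro!: divide_right_mono)
    have "u \<one> + u' \<one> / q \<le> (1 - t) + t"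
      using u d(2) t(3) by (intro add_mono) auto
    then have "(u \<one> + u' \<one> / q) / 2 \<le> 1 / 2" by (intro divide_right_mono) auto
    moreover have "u \<one> - u' \<one> / q \<le> 1 - 0"
      using u d(1) t(1) by (intro diff_mono) auto
    then have "(u \<one> - u' \<one> / q) / 2 \<le> 1 / 2" by (intro divide_right_mono) auto
    moreover note t n
    ultimately show ?thesis by (simp only: \<epsilon>_def e split: if_split) blast
  qed
  ultimately show ?thesis by blast
qed

text \<open>All orbit lengths divide p^r; if none were 1, all would be multiples of p, and so would
  be the size of \<open>W\<close>.\<close>

lemma fixed_point_of_prime_power_period:
  assumes fin: "finite W" and f: "\<And>x. x \<in> W \<Longrightarrow> f x \<in> W"
    and per: "\<And>x. x \<in> W \<Longrightarrow> (f ^^ (p ^ r)) x = x"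
    and p: "Factorial_Ring.prime p" and ndvd: "\<not> p dvd card W"
  shows "\<exists>x\<in>W. f x = x"
proof (rule ccontr)
  assume nofix: "\<not> ?thesis"
  have fW: "(f ^^ i) x \<in> W" if "x \<in> W" for i x
    by (induction i) (use f that in auto)
  define r' where "r' = {(x, y). x \<in> W \<and> y \<in> W \<and> (\<exists>i. (f ^^ i) x = y)}"
  have p0: "p ^ r > 0" using p by (simp add: prime_gt_0_nat)
  have "sym r'"
  proof (rule symI)
    fix x y assume "(x, y) \<in> r'"
    then obtain i where xy: "x \<in> W" "y \<in> W" "(f ^^ i) x = y" by (auto simp: r'_def)
    have "(f ^^ (p ^ r * Suc i)) x = x" for i
      by (induction i) (use per xy in \<open>auto simp: funpow_add\<close>)
    \<comment> \<open>A multiple of the period that is at least i lets the i steps from x to y be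
      completed to a return to x, so reachability is symmetric.\<close>
    moreover have "p ^ r * Suc i = (p ^ r * Suc i - i) + i"
    proof -
      have "i \<le> 1 * Suc i" by simp
      also have "\<dots> \<le> p ^ r * Suc i" using p0 by (intro mult_right_mono) auto
      finally show ?thesis by simp
    qed
    ultimately have "(f ^^ (p ^ r * Suc i - i)) y = x"
      using xy(3) by (metis comp_apply funpow_add)
    then show "(y, x) \<in> r'" using xy by (auto simp: r'_def)
  qed
  moreover have "refl_on W r'" by (auto simp: refl_on_def r'_def intro: exI[of _ 0])
  moreover have "trans r'"
    by (rule transI) (auto simp: r'_def funpow_add[symmetric] simp flip: comp_apply[of "_ ^^ _"])
  moreover have "r' \<subseteq> W \<times> W" by (auto simp: r'_def)
  ultimately have equiv: "equiv W r'" by (simp add: equiv_def)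
  have "p dvd card C" if CW: "C \<in> W // r'" for C
  proof -
    obtain x where x: "x \<in> W" and C: "C = r' `` {x}" using CW by (rule quotientE)
    \<comment> \<open>The least period of x, which is the size of its orbit.\<close>
    define m where "m = (LEAST m. m > 0 \<and> (f ^^ m) x = x)"
    have m: "m > 0" "(f ^^ m) x = x"
      using LeastI[of "\<lambda>m. m > 0 \<and> (f ^^ m) x = x" "p ^ r"] per[OF x] p0 by (auto simp: m_def)
    have least: "m \<le> k" if "k > 0" "(f ^^ k) x = x" for k
      unfolding m_def using that by (intro Least_le) auto
    have "(f ^^ (p ^ r mod m)) x = x" using funpow_mod_eq[OF m(2)] per[OF x] by metis
    then have "p ^ r mod m = 0"
      using least[of "p ^ r mod m"] m(1) by (meson mod_less_divisor not_gr_zero not_less)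
    then have "m dvd p ^ r" by auto
    moreover have "m \<noteq> 1" using m(2) nofix x by auto
    ultimately have "p dvd m"
      using p by (metis divides_primepow_nat dvd_power not_gr_zero power_0)
    moreover have "C = (\<lambda>i. (f ^^ i) x) ` {..<m}"
    proof -
      have "(f ^^ i) x \<in> (\<lambda>i. (f ^^ i) x) ` {..<m}" for i
        using funpow_mod_eq[OF m(2), of i] m(1) by (metis imageI lessThan_iff mod_less_divisor)
      then show ?thesis using x fW by (auto simp: C r'_def)
    qed
    moreover have "inj_on (\<lambda>i. (f ^^ i) x) {..<m}"
    proof -
      have "(f ^^ i) x \<noteq> (f ^^ j) x" if ij: "i < j" "j < m" for i j
      proof
        assume "(f ^^ i) x = (f ^^ j) x"
        then have "(f ^^ (m - j)) ((f ^^ i) x) = (f ^^ (m - j)) ((f ^^ j) x)" by simp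
        then have "(f ^^ (m - j + i)) x = (f ^^ (m - j + j)) x"
          by (simp only: funpow_add comp_apply)
        then have "(f ^^ (m - j + i)) x = x" using m ij by simp
        then show False using least[of "m - j + i"] ij by auto
      qed
      then show ?thesis by (intro inj_onI) (metis lessThan_iff nat_neq_iff)
    qed
    ultimately show ?thesis by (simp add: card_image)
  qed
  then have "p dvd card W" by (rule equiv_imp_dvd_card[OF fin equiv])
  with ndvd show False ..
qed

section \<open>Passage from SL2 to PSL2\<close>

context finite_odd_field
begin

definition neg_one :: "'a \<times> 'a \<times> 'a \<times> 'a" where
  "neg_one = (\<ominus> \<one>, \<zero>, \<zero>, \<ominus> \<one>)"

abbreviation "center \<equiv> {(\<one>, \<zero>, \<zero>, \<one>), (\<ominus> \<one>, \<zero>, \<zero>, \<ominus> \<one>)}"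

definition proj :: "'a \<times> 'a \<times> 'a \<times> 'a \<Rightarrow> ('a \<times> 'a \<times> 'a \<times> 'a) set" where
  "proj x = center #>\<^bsub>SL2 R\<^esub> x"

lemma center_eq: "center = {\<one>\<^bsub>SL2 R\<^esub>, neg_one}"
  by (simp add: SL2_one neg_one_def)

lemma neg_one_closed [simp]: "neg_one \<in> carrier (SL2 R)"
  by (simp add: neg_one_def SL2_carrier_iff minus_eq l_minus r_minus)

lemma neg_one_sq: "neg_one \<otimes>\<^bsub>SL2 R\<^esub> neg_one = \<one>\<^bsub>SL2 R\<^esub>"
  by (simp add: neg_one_def SL2_mult SL2_one l_minus r_minus)

lemma neg_one_comm:
  assumes "x \<in> carrier (SL2 R)"
  shows "neg_one \<otimes>\<^bsub>SL2 R\<^esub> x = x \<otimes>\<^bsub>SL2 R\<^esub> neg_one"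
  using assms by (cases x) (simp add: neg_one_def SL2_mult SL2_carrier_iff l_minus r_minus)

lemma minus_one_neq_one: "\<ominus> \<one> \<noteq> \<one>"
proof
  assume "\<ominus> \<one> = \<one>"
  then have "\<one> \<oplus> \<one> = \<zero>" by (metis one_closed r_neg)
  with two_nonzero show False ..
qed

lemma neg_one_neq_one: "neg_one \<noteq> \<one>\<^bsub>SL2 R\<^esub>"
  using minus_one_neq_one by (simp add: neg_one_def SL2_one)

lemma act_neg_one: "v \<in> carrier R \<times> carrier R \<Longrightarrow> act neg_one v = scale2 (\<ominus> \<one>) v"
  by (cases v) (auto simp: neg_one_def)

lemma normal_center: "center \<lhd> SL2 R"
  unfolding center_eq
proof (rule SL.normal_invI)
  have "inv\<^bsub>SL2 R\<^esub> neg_one = neg_one"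
    using neg_one_sq by (intro SL.inv_equality) auto
  then show "subgroup {\<one>\<^bsub>SL2 R\<^esub>, neg_one} (SL2 R)"
    by (intro SL.subgroupI) (auto simp: neg_one_sq)
  fix x h assume x: "x \<in> carrier (SL2 R)" and h: "h \<in> {\<one>\<^bsub>SL2 R\<^esub>, neg_one}"
  have "x \<otimes>\<^bsub>SL2 R\<^esub> neg_one \<otimes>\<^bsub>SL2 R\<^esub> inv\<^bsub>SL2 R\<^esub> x = neg_one"
    using x by (simp add: neg_one_comm[symmetric] SL.m_assoc)
  then show "x \<otimes>\<^bsub>SL2 R\<^esub> h \<otimes>\<^bsub>SL2 R\<^esub> inv\<^bsub>SL2 R\<^esub> x \<in> {\<one>\<^bsub>SL2 R\<^esub>, neg_one}"
    using x h by auto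
qed

lemma PSL2_eq: "PSL2 R = SL2 R Mod center"
  by (simp add: PSL2_def)

sublocale PSL: group "PSL2 R"
  unfolding PSL2_eq by (rule normal.factorgroup_is_group[OF normal_center])

lemma proj_eq: "proj x = {\<one>\<^bsub>SL2 R\<^esub> \<otimes>\<^bsub>SL2 R\<^esub> x, neg_one \<otimes>\<^bsub>SL2 R\<^esub> x}"
  unfolding proj_def center_eq by (auto simp: r_coset_def)

lemma carrier_PSL2: "carrier (PSL2 R) = proj ` carrier (SL2 R)"
  unfolding PSL2_eq FactGroup_def RCOSETS_def proj_def by auto

lemma proj_closed [simp]: "x \<in> carrier (SL2 R) \<Longrightarrow> proj x \<in> carrier (PSL2 R)"
  by (simp add: carrier_PSL2)

lemma proj_mult:
  "x \<in> carrier (SL2 R) \<Longrightarrow> y \<in> carrier (SL2 R) \<Longrightarrow> proj (x \<otimes>\<^bsub>SL2 R\<^esub> y) = proj x \<otimes>\<^bsub>PSL2 R\<^esub> proj y"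
  unfolding PSL2_eq FactGroup_def proj_def by (simp add: normal.rcos_sum[OF normal_center])

lemma proj_hom: "proj \<in> hom (SL2 R) (PSL2 R)"
  by (simp add: hom_def proj_mult)

interpretation proj: group_hom "SL2 R" "PSL2 R" proj
  by unfold_locales (rule proj_hom)

lemma proj_eq_iff:
  assumes "x \<in> carrier (SL2 R)" "y \<in> carrier (SL2 R)"
  shows "proj x = proj y \<longleftrightarrow> x = y \<or> x = neg_one \<otimes>\<^bsub>SL2 R\<^esub> y"
proof -
  have "neg_one \<otimes>\<^bsub>SL2 R\<^esub> (neg_one \<otimes>\<^bsub>SL2 R\<^esub> y) = y"
    using assms by (simp add: SL.m_assoc[symmetric] neg_one_sq)
  then show ?thesis using assms by (auto simp: proj_eq doubleton_eq_iff)
qed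

lemma finite_PSL2: "finite (carrier (PSL2 R))"
  by (simp add: carrier_PSL2 finite_SL2)

lemma card_PSL2: "real (card (carrier (PSL2 R))) = real q * ((real q)\<^sup>2 - 1) / 2"
proof -
  have "card (carrier (PSL2 R)) * card center = Coset.order (SL2 R)"
    using SL.lagrange_finite[OF finite_SL2 normal_imp_subgroup[OF normal_center]]
    by (simp add: PSL2_eq FactGroup_def)
  moreover have "card center = 2" using minus_one_neq_one by simp
  ultimately have "card (carrier (PSL2 R)) * 2 = (q * q - 1) * q"
    by (simp add: Coset.order_def card_SL2)
  then have "real (card (carrier (PSL2 R))) * 2 = real (q * q - 1) * real q"
    by (metis of_nat_mult of_nat_numeral)
  then show ?thesis using q_gt_1 by (simp add: of_nat_diff Suc_le_eq power2_eq_square mult.commute)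
qed

lemma eigenvecs_neg:
  assumes x: "x \<in> carrier (SL2 R)"
  shows "eigenvecs (neg_one \<otimes>\<^bsub>SL2 R\<^esub> x) = eigenvecs x"
proof -
  have "det2 v (act (neg_one \<otimes>\<^bsub>SL2 R\<^esub> x) v) = \<zero> \<longleftrightarrow> det2 v (act x v) = \<zero>" if "v \<in> vecs" for v
  proof -
    note c = vecs_carrier[OF that] act_closed[OF x vecs_carrier[OF that]]
    have "det2 v (act (neg_one \<otimes>\<^bsub>SL2 R\<^esub> x) v) = \<ominus> \<one> \<otimes> det2 v (act x v)"
      using c x by (simp add: act_mult act_neg_one det2_scale2_right)
    then show ?thesis using det2_closed[OF c] integral_iff[of "\<ominus> \<one>" "det2 v (act x v)"] by auto
  qed
  then show ?thesis unfolding eigenvecs_def by (intro arg_cong[where f = card]) auto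
qed

text \<open>Otherwise the traces 2 and -2 would agree, so that 4 = 0, against odd characteristic.
  Hence a unipotent coset has a unique unipotent lift.\<close>

lemma fix_neg_disjoint:
  assumes u: "u \<in> SL2_fix"
  shows "neg_one \<otimes>\<^bsub>SL2 R\<^esub> u \<notin> SL2_fix"
proof
  assume nu: "neg_one \<otimes>\<^bsub>SL2 R\<^esub> u \<in> SL2_fix"
  obtain a e c d where u': "u = (a, e, c, d)" by (cases u)
  have uS: "(a, e, c, d) \<in> carrier (SL2 R)" using u SL2_fix_subset by (auto simp: u')
  then have cs [simp]: "a \<in> carrier R" "e \<in> carrier R" "c \<in> carrier R" "d \<in> carrier R"
    by (auto simp: SL2_carrier_iff)
  have n: "neg_one \<otimes>\<^bsub>SL2 R\<^esub> u = (\<ominus> a, \<ominus> e, \<ominus> c, \<ominus> d)"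
    by (simp add: neg_one_def u' SL2_mult l_minus)
  have "a \<oplus> d = \<one> \<oplus> \<one>" using u SL2_fix_iff_trace[OF uS] by (simp add: u')
  moreover have "\<ominus> a \<oplus> \<ominus> d = \<one> \<oplus> \<one>"
    using nu SL2_fix_subset SL2_fix_iff_trace[of "\<ominus> a" "\<ominus> e" "\<ominus> c" "\<ominus> d"] by (auto simp: n)
  moreover have "(a \<oplus> d) \<oplus> (\<ominus> a \<oplus> \<ominus> d) = \<zero>" using cs by algebra
  ultimately have "(\<one> \<oplus> \<one>) \<oplus> (\<one> \<oplus> \<one>) = \<zero>" by simp
  moreover have "(\<one> \<oplus> \<one>) \<otimes> (\<one> \<oplus> \<one>) = (\<one> \<oplus> \<one>) \<oplus> (\<one> \<oplus> \<one>)" by (simp add: l_distr)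
  ultimately show False using two_nonzero integral_iff[of "\<one> \<oplus> \<one>" "\<one> \<oplus> \<one>"] by simp
qed

lemma proj_in_fix_iff:
  assumes "x \<in> carrier (SL2 R)"
  shows "proj x \<in> proj ` SL2_fix \<longleftrightarrow> x \<in> SL2_fix \<or> neg_one \<otimes>\<^bsub>SL2 R\<^esub> x \<in> SL2_fix"
proof
  assume "proj x \<in> proj ` SL2_fix"
  then obtain u where u: "u \<in> SL2_fix" "proj u = proj x" by auto
  then show "x \<in> SL2_fix \<or> neg_one \<otimes>\<^bsub>SL2 R\<^esub> x \<in> SL2_fix"
    using proj_eq_iff[of u x] assms SL2_fix_subset by auto
next
  assume "x \<in> SL2_fix \<or> neg_one \<otimes>\<^bsub>SL2 R\<^esub> x \<in> SL2_fix"
  moreover have "proj (neg_one \<otimes>\<^bsub>SL2 R\<^esub> x) = proj x"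
    using assms by (subst proj_eq_iff) auto
  ultimately show "proj x \<in> proj ` SL2_fix" by (metis imageI)
qed

lemma inj_on_proj_fix: "inj_on proj SL2_fix"
proof (rule inj_onI)
  fix x y assume "x \<in> SL2_fix" "y \<in> SL2_fix" "proj x = proj y"
  then show "x = y" using proj_eq_iff[of x y] SL2_fix_subset fix_neg_disjoint[of y] by auto
qed

text \<open>The number of fixed points on the projective line: each contributes q - 1 eigenvectors, and
  the chosen lift of s does not matter because x and -x have the same eigenvectors.\<close>

definition fixed_points :: "('a \<times> 'a \<times> 'a \<times> 'a) set \<Rightarrow> real" where
  "fixed_points s = real (eigenvecs (SOME x. x \<in> carrier (SL2 R) \<and> proj x = s)) / (real q - 1)"

lemma fixed_points_proj:
  assumes x: "x \<in> carrier (SL2 R)"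
  shows "fixed_points (proj x) = real (eigenvecs x) / (real q - 1)"
proof -
  define y where "y = (SOME y. y \<in> carrier (SL2 R) \<and> proj y = proj x)"
  have y: "y \<in> carrier (SL2 R) \<and> proj y = proj x"
    unfolding y_def by (rule someI[of _ x]) (simp add: x)
  then have "eigenvecs y = eigenvecs x"
    using proj_eq_iff[of y x] eigenvecs_neg[OF x] x by auto
  then show ?thesis by (simp add: fixed_points_def y_def)
qed

lemma sum_proj_fix:
  assumes "x \<in> carrier (SL2 R)"
  shows "(\<Sum>z\<in>proj ` SL2_fix. g (inv\<^bsub>PSL2 R\<^esub> z \<otimes>\<^bsub>PSL2 R\<^esub> proj x)) =
    (\<Sum>u\<in>SL2_fix. g (proj (inv\<^bsub>SL2 R\<^esub> u \<otimes>\<^bsub>SL2 R\<^esub> x)))"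
  unfolding sum.reindex[OF inj_on_proj_fix] o_def
  using assms SL2_fix_subset by (intro sum.cong refl) (auto simp: subset_iff proj_mult)

text \<open>The counting identities of SL2, divided by q - 1 and summed over unipotent lifts, are
  the hypotheses of the abstract construction.\<close>

lemma spectral_family_PSL2:
  assumes q: "q \<ge> 5"
  shows "\<exists>A \<epsilon>. spectral_family (PSL2 R) (proj ` SL2_fix) A \<epsilon> \<and> (\<forall>a\<in>A. \<epsilon> a \<one>\<^bsub>PSL2 R\<^esub> \<le> 1 / 2)"
proof (rule PSL.spectral_family_of_point_count[where f = fixed_points and q = "real q"])
  have PS: "u \<in> carrier (SL2 R)" if "u \<in> SL2_fix" for u using that SL2_fix_subset by auto
  have q1: "real q - 1 \<noteq> 0" using q by auto
  show "finite (carrier (PSL2 R))" by (rule finite_PSL2)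
  show "proj ` SL2_fix \<subseteq> carrier (PSL2 R)" using SL2_fix_subset by auto
  show "inv\<^bsub>PSL2 R\<^esub> z \<in> proj ` SL2_fix" if "z \<in> proj ` SL2_fix" for z
    using that SL2_fix_inv PS by (auto simp flip: proj.hom_inv)
  show "\<one>\<^bsub>PSL2 R\<^esub> \<in> proj ` SL2_fix"
    using one_SL2_fix proj.hom_one by (metis imageI)
  show "real q \<ge> 5" using q by simp
  show "real (card (carrier (PSL2 R))) = real q * ((real q)\<^sup>2 - 1) / 2" by (rule card_PSL2)
  show "real (card (proj ` SL2_fix)) = (real q)\<^sup>2"
    by (simp add: card_image[OF inj_on_proj_fix] card_SL2_fix)
  have fp1: "fixed_points \<one>\<^bsub>PSL2 R\<^esub> = real q + 1"
  proof -
    have "{v \<in> vecs. det2 v (act \<one>\<^bsub>SL2 R\<^esub> v) = \<zero>} = vecs"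
      using act_one vecs_carrier det2_self by auto
    then have "real (eigenvecs \<one>\<^bsub>SL2 R\<^esub>) = (real q + 1) * (real q - 1)"
      using q by (simp add: eigenvecs_def card_vecs of_nat_diff Suc_le_eq algebra_simps)
    then show ?thesis using fixed_points_proj[OF SL.one_closed] q1 by simp
  qed
  then show "fixed_points \<one>\<^bsub>PSL2 R\<^esub> = real q + 1" .
  fix s assume "s \<in> carrier (PSL2 R)"
  then obtain x where x: "x \<in> carrier (SL2 R)" and s: "s = proj x" by (auto simp: carrier_PSL2)
  let ?i = "\<lambda>u. inv\<^bsub>SL2 R\<^esub> u \<otimes>\<^bsub>SL2 R\<^esub> x"
  show "(\<Sum>z\<in>proj ` SL2_fix. fixed_points (inv\<^bsub>PSL2 R\<^esub> z \<otimes>\<^bsub>PSL2 R\<^esub> s)) = fixed_points s + (real q)\<^sup>2 - 1"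
  proof -
    have "(\<Sum>z\<in>proj ` SL2_fix. fixed_points (inv\<^bsub>PSL2 R\<^esub> z \<otimes>\<^bsub>PSL2 R\<^esub> s)) =
        (\<Sum>u\<in>SL2_fix. real (eigenvecs (?i u)) / (real q - 1))"
      unfolding s sum_proj_fix[OF x] using x PS by (intro sum.cong refl fixed_points_proj) auto
    also have "\<dots> = ((real q - 1) * ((real q)\<^sup>2 - 1) + eigenvecs x) / (real q - 1)"
      by (simp add: sum_divide_distrib[symmetric] sum_eigenvecs_translate[OF x])
    finally show ?thesis using q1 by (simp add: s fixed_points_proj[OF x] add_divide_distrib)
  qed
  show "(\<Sum>z\<in>proj ` SL2_fix. of_bool (inv\<^bsub>PSL2 R\<^esub> z \<otimes>\<^bsub>PSL2 R\<^esub> s \<in> proj ` SL2_fix)) =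
    (real q)\<^sup>2 * of_bool (s = \<one>\<^bsub>PSL2 R\<^esub>) + 2 * (real q + 1) - 2 * fixed_points s"
  proof -
    let ?n = "\<lambda>x. neg_one \<otimes>\<^bsub>SL2 R\<^esub> x"
    have nx: "?n x \<in> carrier (SL2 R)" using x by simp
    \<comment> \<open>A coset lies in the image of \<open>SL2_fix\<close> iff exactly one of its two
      lifts is unipotent, so the count in PSL2 is the sum of the factorization counts of x and
      -x.\<close>
    have "(\<Sum>z\<in>proj ` SL2_fix. of_bool (inv\<^bsub>PSL2 R\<^esub> z \<otimes>\<^bsub>PSL2 R\<^esub> s \<in> proj ` SL2_fix)) =
        (\<Sum>u\<in>SL2_fix. of_bool (?i u \<in> SL2_fix) + of_bool (inv\<^bsub>SL2 R\<^esub> u \<otimes>\<^bsub>SL2 R\<^esub> ?n x \<in> SL2_fix) :: real)"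
      unfolding s sum_proj_fix[OF x, where g = "\<lambda>t. of_bool (t \<in> proj ` SL2_fix)"]
    proof (intro sum.cong refl)
      fix u assume u: "u \<in> SL2_fix"
      have "?n (?i u) = inv\<^bsub>SL2 R\<^esub> u \<otimes>\<^bsub>SL2 R\<^esub> ?n x"
        using x PS[OF u] neg_one_comm[of "inv\<^bsub>SL2 R\<^esub> u"] by (simp add: SL.m_assoc[symmetric])
      then show "of_bool (proj (?i u) \<in> proj ` SL2_fix) = (of_bool (?i u \<in> SL2_fix) + of_bool (inv\<^bsub>SL2 R\<^esub> u \<otimes>\<^bsub>SL2 R\<^esub> ?n x \<in> SL2_fix) :: real)"
        using proj_in_fix_iff[of "?i u"] fix_neg_disjoint[of "?i u"] x PS[OF u] by auto
    qed
    also have "\<dots> = fix_factorizations x + fix_factorizations (?n x)"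
      by (simp only: sum.distrib sum_of_bool_card[OF finite_SL2_fix] fix_factorizations_def)
    finally have "(real q - 1) * (\<Sum>z\<in>proj ` SL2_fix. of_bool (inv\<^bsub>PSL2 R\<^esub> z \<otimes>\<^bsub>PSL2 R\<^esub> s \<in> proj ` SL2_fix)) =
        (real q)\<^sup>2 * (real q - 1) * (of_bool (x = \<one>\<^bsub>SL2 R\<^esub>) + of_bool (?n x = \<one>\<^bsub>SL2 R\<^esub>)) + 2 * ((real q)\<^sup>2 - 1) - 2 * eigenvecs x"
      by (simp add: distrib_left fix_factorizations_eq[OF x] fix_factorizations_eq[OF nx] eigenvecs_neg[OF x])
    moreover have "of_bool (x = \<one>\<^bsub>SL2 R\<^esub>) + of_bool (?n x = \<one>\<^bsub>SL2 R\<^esub>) = (of_bool (s = \<one>\<^bsub>PSL2 R\<^esub>) :: real)"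
    proof -
      have "?n x = \<one>\<^bsub>SL2 R\<^esub> \<longleftrightarrow> x = neg_one"
        using x neg_one_sq by (metis SL.inv_equality SL.inv_inv neg_one_closed)
      moreover have "s = \<one>\<^bsub>PSL2 R\<^esub> \<longleftrightarrow> x = \<one>\<^bsub>SL2 R\<^esub> \<or> x = neg_one"
        using proj_eq_iff[OF x SL.one_closed] by (simp add: s)
      ultimately show ?thesis using neg_one_neq_one by auto
    qed
    moreover have "real (eigenvecs x) = (real q - 1) * fixed_points s"
      using q1 by (simp add: s fixed_points_proj[OF x])
    ultimately have "(real q - 1) * (\<Sum>z\<in>proj ` SL2_fix. of_bool (inv\<^bsub>PSL2 R\<^esub> z \<otimes>\<^bsub>PSL2 R\<^esub> s \<in> proj ` SL2_fix)) =
        (real q - 1) * ((real q)\<^sup>2 * of_bool (s = \<one>\<^bsub>PSL2 R\<^esub>) + 2 * (real q + 1) - 2 * fixed_points s)"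
      by (simp only:) (simp add: algebra_simps power2_eq_square)
    then show ?thesis using q1 by simp
  qed
qed

text \<open>The stabiliser of a fixed vector is a subgroup of order q, so Lagrange's theorem
  applies.\<close>

lemma SL2_fix_pow:
  assumes u: "u \<in> SL2_fix"
  shows "u [^]\<^bsub>SL2 R\<^esub> q = \<one>\<^bsub>SL2 R\<^esub>"
proof -
  obtain v where v: "v \<in> vecs" "act u v = v" and uS: "u \<in> carrier (SL2 R)"
    using u by (auto simp: SL2_fix_def)
  define H where "H = {u \<in> carrier (SL2 R). act u v = v}"
  note vc = vecs_carrier[OF v(1)]
  have H: "subgroup H (SL2 R)"
  proof (rule SL.subgroupI)
    show "H \<noteq> {}" using v uS unfolding H_def by blast
    show "H \<subseteq> carrier (SL2 R)" by (auto simp: H_def)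
    show "inv\<^bsub>SL2 R\<^esub> m \<in> H" if "m \<in> H" for m
      using that vc act_eq_iff[of m v v] by (auto simp: H_def)
    show "m \<otimes>\<^bsub>SL2 R\<^esub> n \<in> H" if "m \<in> H" "n \<in> H" for m n
      using that vc by (auto simp: H_def act_mult)
  qed
  interpret H: group "SL2 R\<lparr>carrier := H\<rparr>" by (rule SL.subgroup_imp_group[OF H])
  have "Coset.order (SL2 R\<lparr>carrier := H\<rparr>) = q"
    using card_transporter[OF v(1) v(1)] by (simp add: Coset.order_def H_def)
  moreover have "u \<in> carrier (SL2 R\<lparr>carrier := H\<rparr>)" using v uS by (simp add: H_def)
  ultimately have "u [^]\<^bsub>SL2 R\<lparr>carrier := H\<rparr>\<^esub> q = \<one>\<^bsub>SL2 R\<^esub>"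
    using H.pow_order_eq_1 by fastforce
  then show ?thesis by (metis SL.nat_pow_consistent)
qed

lemma act_pow:
  assumes "x \<in> carrier (SL2 R)" "v \<in> carrier R \<times> carrier R"
  shows "act (x [^]\<^bsub>SL2 R\<^esub> (n::nat)) v = (act x ^^ n) v"
proof (induction n)
  case (Suc n)
  have "act (x [^]\<^bsub>SL2 R\<^esub> Suc n) v = act (x \<otimes>\<^bsub>SL2 R\<^esub> x [^]\<^bsub>SL2 R\<^esub> n) v"
    using assms by (metis SL.nat_pow_Suc2)
  then show ?case using assms Suc by (simp add: act_mult)
qed (simp add: act_one assms)

text \<open>y permutes the q^2 - 1 nonzero vectors with period q, and p does not divide q^2 -
  1.\<close>

lemma SL2_fix_of_pow_eq_one:
  assumes y: "y \<in> carrier (SL2 R)" "y [^]\<^bsub>SL2 R\<^esub> q = \<one>\<^bsub>SL2 R\<^esub>"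
    and p: "Factorial_Ring.prime p" "q = p ^ r" "r > 0"
  shows "y \<in> SL2_fix"
proof -
  have "\<exists>v\<in>vecs. act y v = v"
  proof (rule fixed_point_of_prime_power_period[OF finite_vecs _ _ p(1)])
    show "act y v \<in> vecs" if "v \<in> vecs" for v using act_vecs[OF y(1) that] .
    show "(act y ^^ (p ^ r)) v = v" if "v \<in> vecs" for v
      using act_pow[OF y(1) vecs_carrier[OF that], of q] y(2) act_one[OF vecs_carrier[OF that]]
      by (simp add: p(2))
    show "\<not> p dvd card vecs"
    proof
      assume "p dvd card vecs"
      moreover have "p dvd q * q" using p(2,3) by simp
      moreover have "q * q = card vecs + 1" using q_gt_1 by (simp add: card_vecs)
      ultimately have "p dvd 1" by (metis dvd_add_right_iff)
      then show False using p(1) by simp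
    qed
  qed
  then show ?thesis using y(1) by (auto simp: SL2_fix_def)
qed

text \<open>If x^q = 1 or x^q = -1, then (x^2)^q = 1, so x^2 fixes a vector, and hence so does
  x^(q+1), which is x or -x.\<close>

lemma proj_fix_eq:
  assumes p: "Factorial_Ring.prime p" "q = p ^ r" "r > 0" and odd: "odd q"
  shows "proj ` SL2_fix = {s \<in> carrier (PSL2 R). s [^]\<^bsub>PSL2 R\<^esub> q = \<one>\<^bsub>PSL2 R\<^esub>}"
proof (intro equalityI subsetI)
  fix s assume "s \<in> proj ` SL2_fix"
  then obtain u where u: "u \<in> SL2_fix" "s = proj u" by auto
  then have uS: "u \<in> carrier (SL2 R)" using SL2_fix_subset by auto
  have "s [^]\<^bsub>PSL2 R\<^esub> q = proj (u [^]\<^bsub>SL2 R\<^esub> q)" using uS by (simp add: u proj.hom_nat_pow)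
  then show "s \<in> {s \<in> carrier (PSL2 R). s [^]\<^bsub>PSL2 R\<^esub> q = \<one>\<^bsub>PSL2 R\<^esub>}"
    using uS SL2_fix_pow[OF u(1)] by (simp add: u)
next
  fix s assume "s \<in> {s \<in> carrier (PSL2 R). s [^]\<^bsub>PSL2 R\<^esub> q = \<one>\<^bsub>PSL2 R\<^esub>}"
  then obtain x where x: "x \<in> carrier (SL2 R)" and s: "s = proj x" and "proj x [^]\<^bsub>PSL2 R\<^esub> q = \<one>\<^bsub>PSL2 R\<^esub>"
    by (auto simp: carrier_PSL2)
  then have "proj (x [^]\<^bsub>SL2 R\<^esub> q) = proj \<one>\<^bsub>SL2 R\<^esub>" by (simp add: proj.hom_nat_pow)
  then have xq: "x [^]\<^bsub>SL2 R\<^esub> q = \<one>\<^bsub>SL2 R\<^esub> \<or> x [^]\<^bsub>SL2 R\<^esub> q = neg_one"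
    using x by (subst (asm) proj_eq_iff) auto
  define y where "y = x [^]\<^bsub>SL2 R\<^esub> (2::nat)"
  have y: "y \<in> carrier (SL2 R)" using x by (simp add: y_def)
  have "y [^]\<^bsub>SL2 R\<^esub> q = x [^]\<^bsub>SL2 R\<^esub> q \<otimes>\<^bsub>SL2 R\<^esub> x [^]\<^bsub>SL2 R\<^esub> q"
    using x by (simp add: y_def SL.nat_pow_pow SL.nat_pow_mult mult_2)
  then have "y [^]\<^bsub>SL2 R\<^esub> q = \<one>\<^bsub>SL2 R\<^esub>" using xq neg_one_sq by auto
  then have "y \<in> SL2_fix" using SL2_fix_of_pow_eq_one[OF y _ p] by simp
  then obtain v where v: "v \<in> vecs" "act y v = v" by (auto simp: SL2_fix_def)
  define z where "z = x [^]\<^bsub>SL2 R\<^esub> (q + 1)"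
  obtain k where k: "q + 1 = 2 * k" using odd by (metis even_plus_one_iff evenE)
  have "z = y [^]\<^bsub>SL2 R\<^esub> k" unfolding z_def k y_def using x by (simp add: SL.nat_pow_pow)
  moreover have "(act y ^^ k) v = v" by (induction k) (simp_all add: v)
  ultimately have "act z v = v" using act_pow[OF y vecs_carrier[OF v(1)]] by simp
  then have "z \<in> SL2_fix" using v x by (auto simp: SL2_fix_def z_def)
  moreover have "z = x \<or> z = neg_one \<otimes>\<^bsub>SL2 R\<^esub> x"
    using xq x by (auto simp: z_def)
  ultimately have "x \<in> SL2_fix \<or> neg_one \<otimes>\<^bsub>SL2 R\<^esub> x \<in> SL2_fix" by auto
  then show "s \<in> proj ` SL2_fix" using proj_in_fix_iff[OF x] by (simp add: s)
qed

end

text \<open>If 1 + 1 = 0, adding 1 would be an involution of a set of odd size and would have a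
  fixed point, giving 1 = 0.\<close>

lemma (in field) finite_odd_fieldI:
  assumes "finite (carrier R)" "odd (card (carrier R))"
  shows "finite_odd_field R"
proof
  show "finite (carrier R)" by fact
  show "\<one> \<oplus> \<one> \<noteq> \<zero>"
  proof
    assume two: "\<one> \<oplus> \<one> = \<zero>"
    have "\<exists>x\<in>carrier R. x \<oplus> \<one> = x"
    proof (rule fixed_point_of_prime_power_period[where p = 2 and r = 1])
      show "((\<lambda>x. x \<oplus> \<one>) ^^ 2 ^ 1) x = x" if "x \<in> carrier R" for x
        using that two by (simp add: numeral_2_eq_2 a_assoc)
    qed (use assms in auto)
    then obtain x where x: "x \<in> carrier R" "x \<oplus> \<one> = x \<oplus> \<zero>" by auto
    then have "\<one> = \<zero>" by (metis add.l_cancel one_closed zero_closed)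
    then show False by simp
  qed
qed

section \<open>The degree bound\<close>

text \<open>The trace bound for the point mass at the identity. This crude estimate makes the set of
  degrees finite.\<close>

lemma (in group) degree_square_le_order:
  assumes fin: "finite (carrier G)" and irr: "is_irrep G n \<rho>"
  shows "n\<^sup>2 \<le> order G"
proof -
  have "is_rep G n \<rho>" using irr by (simp add: is_irrep_def)
  then have "(real n)\<^sup>2 \<le> real (order G) * (\<Sum>x\<in>{\<one>}. 1\<^sup>2)"
    by (intro degree_bound_of_trace[OF fin irr, where \<phi> = id])
      (auto simp: is_rep_def mat_trace_def)
  then show ?thesis by (simp flip: of_nat_power)
qed

lemma (in group) trivial_irrep: "is_irrep G 1 (\<lambda>_. 1\<^sub>m 1)"
proof -
  have "W = {0\<^sub>v 1} \<or> W = carrier_vec 1" if W: "is_subspace 1 W" for W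
  proof (cases "W \<subseteq> {0\<^sub>v 1}")
    case True
    then show ?thesis using W by (auto simp: is_subspace_def)
  next
    case False
    then obtain w where w: "w \<in> W" "w \<noteq> 0\<^sub>v 1" by auto
    then have wc: "w \<in> carrier_vec 1" using W by (auto simp: is_subspace_def)
    then have w0: "w $ 0 \<noteq> 0" using w(2) by (metis One_nat_def eq_vecI carrier_vecD index_zero_vec less_one)
    have "v \<in> W" if v: "v \<in> carrier_vec 1" for v
    proof -
      have "v = (v $ 0 / w $ 0) \<cdot>\<^sub>v w"
        using v wc w0 by (intro eq_vecI) auto
      then show ?thesis using W w(1) unfolding is_subspace_def by metis
    qed
    then show ?thesis using W by (auto simp: is_subspace_def)
  qed
  then show ?thesis by (auto simp: is_irrep_def is_rep_def)
qed

text \<open>\<open>Max\<close> is meaningful only on a finite nonempty set; the crude degree bound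
  and the trivial representation provide this, so the maximum is attained.\<close>

lemma irrep_of_b:
  assumes "group G" "finite (carrier G)"
  shows "\<exists>\<rho>. is_irrep G (b G) \<rho>"
proof -
  have "n \<le> order G" if "is_irrep G n \<rho>" for n \<rho>
    using group.degree_square_le_order[OF assms that] self_le_power[of n 2]
    by (cases "n = 0") auto
  then have "{n. \<exists>\<rho>. is_irrep G n \<rho>} \<subseteq> {..order G}" by auto
  then have "finite {n. \<exists>\<rho>. is_irrep G n \<rho>}" by (rule finite_subset) simp
  moreover have "{n. \<exists>\<rho>. is_irrep G n \<rho>} \<noteq> {}" using group.trivial_irrep[OF assms(1)] by blast
  ultimately have "b G \<in> {n. \<exists>\<rho>. is_irrep G n \<rho>}" unfolding b_def by (rule Max_in)
  then show ?thesis by simp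
qed

text \<open>With s = sqrt d, the hypothesis gives e \<ge> d = s^2, which exceeds s + 1 for s \<ge>
  2. For smaller d the lower bound on n takes over. The second claim follows by inserting d < (e -
  1)^2 into d(d + e).\<close>

lemma excess_bounds:
  fixes d n e :: real
  assumes d: "d \<ge> 1" and n: "n \<ge> 60" "2 * d\<^sup>2 \<le> n" "n = d * (d + e)"
  shows "e > sqrt d + 1" "n < e ^ 4 - e ^ 3"
proof -
  define s where "s = sqrt d"
  have s: "s \<ge> 1" "d = s\<^sup>2" using d by (auto simp: s_def)
  have e1: "e > s + 1"
  proof (cases "s \<ge> 2")
    case True
    have "d * (2 * d) \<le> d * (d + e)" using n by (simp add: power2_eq_square)
    then have "d \<le> e" using d by simp
    moreover have "s * 2 \<le> s * s" using True by (intro mult_left_mono) auto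
    moreover have "s + 1 < s * 2" using True s by auto
    ultimately show ?thesis unfolding s(2) power2_eq_square by linarith
  next
    case False
    then have "d \<le> 2 * 2" unfolding s(2) power2_eq_square using s by (intro mult_mono) auto
    have "s + 1 < 3" using False by simp
    moreover have "e \<ge> 3"
    proof (rule ccontr)
      assume "\<not> e \<ge> 3"
      \<comment> \<open>With d \<le> 4 and e < 3 the product is at most 4 * 7 = 28, less than
        60.\<close>
      then have "d * (d + e) \<le> d * 7" using d \<open>d \<le> 2 * 2\<close> by (intro mult_left_mono) auto
      then show False using n \<open>d \<le> 2 * 2\<close> by simp
    qed
    ultimately show ?thesis by simp
  qed
  show "e > sqrt d + 1" using e1 by (simp add: s_def)
  have "d < (e - 1)\<^sup>2"
    unfolding s(2) using e1 s by (intro power_strict_mono) auto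
  then have "d * (d + e) < (e - 1)\<^sup>2 * ((e - 1)\<^sup>2 + e)"
    using d e1 s by (intro mult_strict_mono) auto
  also have "\<dots> = (e ^ 4 - e ^ 3) - (e - 1) * (2 * e\<^sup>2 - 2 * e + 1)"
    by (simp add: power2_eq_square power3_eq_cube power4_eq_xxxx algebra_simps)
  also have "\<dots> \<le> e ^ 4 - e ^ 3"
  proof -
    have "0 \<le> e * (e - 1)" using e1 s by simp
    then have "0 \<le> 2 * e\<^sup>2 - 2 * e + 1" by (simp add: power2_eq_square algebra_simps)
    then show ?thesis using e1 s by simp
  qed
  finally show "n < e ^ 4 - e ^ 3" using n(3) by simp
qed

text \<open>The lower bound on the order accompanies the degree bound because 2 d^2 \<le> |G| is too
  weak for small d: for d = 1 it only gives e \<ge> 1. The number 60 is the order of PSL2(5),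
  attained at q = 5.\<close>

lemma minimal_normal_PSL2_power_degree_bound:
  fixes G :: "('a, 'c) monoid_scheme" and F :: "('f, 'm) ring_scheme"
    and q k p r :: nat
  assumes p: "Factorial_Ring.prime p" "r > 0" "q = p ^ r" "odd q" "q \<ge> 5"
    and F: "field F" "finite (carrier F)" "card (carrier F) = q"
    and G: "group G" "finite (carrier G)" and N: "N \<lhd> G" "N \<noteq> {\<one>\<^bsub>G\<^esub>}"
    and iso: "G\<lparr>carrier := N\<rparr> \<cong> product_group {..<k} (\<lambda>_. PSL2 F)"
    and irr: "is_irrep G n \<rho>"
  shows "2 * (real n)\<^sup>2 \<le> real (order G)" "order G \<ge> 60"
proof -
  interpret F: field F by fact
  interpret F: finite_odd_field F
    using F.finite_odd_fieldI F(2,3) p(4) by simp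
  interpret G: group G by fact
  interpret N: normal N G by fact
  let ?PF = "\<lambda>_::nat. PSL2 F"
  let ?\<Pi> = "product_group {..<k} ?PF"
  have grpN: "group (G\<lparr>carrier := N\<rparr>)" by (rule G.subgroup_imp_group[OF N.is_subgroup])
  have grpP: "group ?\<Pi>" by (simp add: F.PSL.is_group)
  from iso have "?\<Pi> \<cong> G\<lparr>carrier := N\<rparr>" by (rule group.iso_sym[OF grpN])
  then obtain \<phi> where \<phi>: "\<phi> \<in> iso ?\<Pi> (G\<lparr>carrier := N\<rparr>)" by (auto simp: is_iso_def)
  then have \<phi>N: "\<phi> \<in> hom ?\<Pi> (G\<lparr>carrier := N\<rparr>)" and bij: "bij_betw \<phi> ({..<k} \<rightarrow>\<^sub>E carrier (PSL2 F)) N"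
    by (auto simp: iso_def)
  have hom: "\<phi> \<in> hom ?\<Pi> G"
    using \<phi>N N.subset by (auto simp: hom_def)
  have inj: "inj_on \<phi> ({..<k} \<rightarrow>\<^sub>E carrier (PSL2 F))" using bij by (rule bij_betw_imp_inj_on)
  have cN: "card N = card (carrier (PSL2 F)) ^ k"
    using bij_betw_same_card[OF bij] by (simp add: card_PiE)
  have k: "k > 0"
  proof (rule ccontr)
    assume "\<not> k > 0"
    then have "card N = 1" using cN by simp
    then obtain x where "N = {x}" by (auto simp: card_1_singleton_iff)
    then show False using N(2) N.one_closed by auto
  qed
  let ?c = "card (carrier (PSL2 F))"
  have "real ?c \<ge> 60"
  proof -
    have q: "real q \<ge> 5" using p(5) by simp
    then have "5 * 5 \<le> real q * real q" by (intro mult_mono) auto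
    then have "5 * 24 \<le> real q * ((real q)\<^sup>2 - 1)"
      using q by (intro mult_mono) (auto simp: power2_eq_square)
    then show ?thesis using F.card_PSL2 by (simp add: F(3))
  qed
  then have "?c \<ge> 60" by simp
  moreover have "?c ^ 1 \<le> ?c ^ k" using k \<open>?c \<ge> 60\<close> by (intro power_increasing) auto
  moreover have "card N \<le> order G"
    unfolding Coset.order_def using G(2) N.subset by (rule card_mono)
  ultimately show "order G \<ge> 60" using cN by simp
  obtain A \<epsilon> where sf: "spectral_family (PSL2 F) (F.proj ` F.SL2_fix) A \<epsilon>"
    and w: "\<And>a. a \<in> A \<Longrightarrow> \<epsilon> a \<one>\<^bsub>PSL2 F\<^esub> \<le> 1 / 2"
    using F.spectral_family_PSL2 p(5) F(3) by auto
  interpret S: spectral_family "PSL2 F" "F.proj ` F.SL2_fix" A \<epsilon> by (rule sf)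
  let ?P = "F.proj ` F.SL2_fix"
  interpret \<phi>: group_hom ?\<Pi> G \<phi>
    using grpP G(1) hom by (simp add: group_hom_def group_hom_axioms_def)
  have P: "?P = {s \<in> carrier (PSL2 F). s [^]\<^bsub>PSL2 F\<^esub> q = \<one>\<^bsub>PSL2 F\<^esub>}"
    using F.proj_fix_eq[OF p(1), of r] p F(3) by simp
  have pow: "x [^]\<^bsub>?\<Pi>\<^esub> m = (\<lambda>i\<in>{..<k}. x i [^]\<^bsub>PSL2 F\<^esub> m)" for x and m :: nat
    by (induction m) (auto simp: fun_eq_iff)
  \<comment> \<open>Powers in the product are taken coordinatewise, so the tuples of unipotent
    elements become the solutions of x^q = 1 in N. This description is intrinsic to N and therefore
    stable under conjugation by all of G.\<close>
  have img: "\<phi> ` ({..<k} \<rightarrow>\<^sub>E ?P) = {x \<in> N. x [^]\<^bsub>G\<^esub> q = \<one>\<^bsub>G\<^esub>}"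
  proof -
    have pow_iff: "\<phi> x [^]\<^bsub>G\<^esub> q = \<one>\<^bsub>G\<^esub> \<longleftrightarrow> x \<in> {..<k} \<rightarrow>\<^sub>E ?P" if x: "x \<in> {..<k} \<rightarrow>\<^sub>E carrier (PSL2 F)" for x
    proof -
      have xc: "x \<in> carrier ?\<Pi>" using x by simp
      have "\<phi> x [^]\<^bsub>G\<^esub> q = \<phi> (x [^]\<^bsub>?\<Pi>\<^esub> q)" using \<phi>.hom_nat_pow[OF xc] by simp
      moreover have "\<phi> (x [^]\<^bsub>?\<Pi>\<^esub> q) = \<phi> \<one>\<^bsub>?\<Pi>\<^esub> \<longleftrightarrow> x [^]\<^bsub>?\<Pi>\<^esub> q = \<one>\<^bsub>?\<Pi>\<^esub>"
        using inj_on_eq_iff[OF inj, of "x [^]\<^bsub>?\<Pi>\<^esub> q" "\<one>\<^bsub>?\<Pi>\<^esub>"]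
          monoid.nat_pow_closed[OF group.is_monoid[OF grpP] xc] monoid.one_closed[OF group.is_monoid[OF grpP]]
        by (simp only: carrier_product_group)
      moreover have "x [^]\<^bsub>?\<Pi>\<^esub> q = \<one>\<^bsub>?\<Pi>\<^esub> \<longleftrightarrow> (\<forall>i\<in>{..<k}. x i [^]\<^bsub>PSL2 F\<^esub> q = \<one>\<^bsub>PSL2 F\<^esub>)"
        unfolding pow one_product_group by (auto simp: fun_eq_iff restrict_def)
      moreover have "\<dots> \<longleftrightarrow> x \<in> {..<k} \<rightarrow>\<^sub>E ?P"
        using x unfolding P by (auto simp: PiE_iff)
      ultimately show ?thesis using \<phi>.hom_one by simp
    qed
    have sub: "{..<k} \<rightarrow>\<^sub>E ?P \<subseteq> {..<k} \<rightarrow>\<^sub>E carrier (PSL2 F)"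
      unfolding P by (rule PiE_mono) auto
    have N_eq: "N = \<phi> ` ({..<k} \<rightarrow>\<^sub>E carrier (PSL2 F))"
      using bij_betw_imp_surj_on[OF bij] by simp
    show ?thesis
    proof (intro equalityI subsetI)
      fix y assume "y \<in> \<phi> ` ({..<k} \<rightarrow>\<^sub>E ?P)"
      then obtain x where x: "x \<in> {..<k} \<rightarrow>\<^sub>E ?P" "y = \<phi> x" by (rule imageE)
      have "x \<in> {..<k} \<rightarrow>\<^sub>E carrier (PSL2 F)" using sub x(1) by (rule subsetD)
      then show "y \<in> {x \<in> N. x [^]\<^bsub>G\<^esub> q = \<one>\<^bsub>G\<^esub>}"
        using pow_iff x unfolding N_eq by simp
    next
      fix y assume y: "y \<in> {x \<in> N. x [^]\<^bsub>G\<^esub> q = \<one>\<^bsub>G\<^esub>}"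
      then have "y \<in> \<phi> ` ({..<k} \<rightarrow>\<^sub>E carrier (PSL2 F))" unfolding N_eq by simp
      then obtain x where x: "x \<in> {..<k} \<rightarrow>\<^sub>E carrier (PSL2 F)" "y = \<phi> x" by (rule imageE)
      then have "x \<in> {..<k} \<rightarrow>\<^sub>E ?P" using pow_iff[OF x(1)] y by simp
      then show "y \<in> \<phi> ` ({..<k} \<rightarrow>\<^sub>E ?P)" unfolding x(2) by (rule imageI)
    qed
  qed
  have conj: "g \<otimes>\<^bsub>G\<^esub> x \<otimes>\<^bsub>G\<^esub> inv\<^bsub>G\<^esub> g \<in> \<phi> ` ({..<k} \<rightarrow>\<^sub>E ?P)"
    if g: "g \<in> carrier G" and x: "x \<in> \<phi> ` ({..<k} \<rightarrow>\<^sub>E ?P)" for g x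
  proof -
    have xN: "x \<in> N" "x [^]\<^bsub>G\<^esub> q = \<one>\<^bsub>G\<^esub>" using x unfolding img by auto
    then have xG: "x \<in> carrier G" using N.subset by auto
    have "(g \<otimes>\<^bsub>G\<^esub> x \<otimes>\<^bsub>G\<^esub> inv\<^bsub>G\<^esub> g) [^]\<^bsub>G\<^esub> m = g \<otimes>\<^bsub>G\<^esub> x [^]\<^bsub>G\<^esub> m \<otimes>\<^bsub>G\<^esub> inv\<^bsub>G\<^esub> g" for m :: nat
    proof (induction m)
      case (Suc m)
      have "inv\<^bsub>G\<^esub> g \<otimes>\<^bsub>G\<^esub> (g \<otimes>\<^bsub>G\<^esub> y) = y" if "y \<in> carrier G" for y
        using g that by (simp flip: G.m_assoc)
      with Suc show ?case using g xG by (simp add: G.m_assoc)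
    qed (use g in simp)
    then have "(g \<otimes>\<^bsub>G\<^esub> x \<otimes>\<^bsub>G\<^esub> inv\<^bsub>G\<^esub> g) [^]\<^bsub>G\<^esub> q = \<one>\<^bsub>G\<^esub>" using xN g by simp
    then show ?thesis unfolding img using N.inv_op_closed2[OF g xN(1)] by simp
  qed
  have "(real n)\<^sup>2 \<le> 1 / 2 * real (order G)"
  proof (rule S.degree_bound[OF G irr _ _ hom inj conj])
    show "S.weight a \<le> 1 / 2" if "a \<in> A" for a using w[OF that] S.weight_eq[OF that] by simp
    show "{..<k} \<noteq> {}" using k by auto
  qed auto
  then show "2 * (real n)\<^sup>2 \<le> real (order G)" by simp
qed

theorem theorem6p1:
  fixes G :: "('a, 'c) monoid_scheme" and N :: "'a set"
    and F :: "('f, 'm) ring_scheme"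
    and q k p r :: nat and e :: real
  assumes "Factorial_Ring.prime p" and "r > 0" and "q = p ^ r" and "odd q" and "q \<ge> 5"
    and "field F" and "finite (carrier F)" and "card (carrier F) = q"
    and "group G" and "finite (carrier G)"
    and "minimal_normal N G"
    and "G\<lparr>carrier := N\<rparr> \<cong> product_group {..<k} (\<lambda>_. PSL2 F)"
    and "card (carrier (G Mod N)) \<ge> q ^ k"
    and "real (order G) = real (b G) * (real (b G) + e)"
  shows "e > sqrt (real (b G)) + 1 \<and> real (order G) < e ^ 4 - e ^ 3"
proof -
  obtain \<rho> where irr: "is_irrep G (b G) \<rho>" using irrep_of_b assms(9,10) by blast
  have N: "N \<lhd> G" "N \<noteq> {\<one>\<^bsub>G\<^esub>}" using assms(11) by (auto simp: minimal_normal_def)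
  note bound = minimal_normal_PSL2_power_degree_bound[OF assms(1-10) N assms(12) irr]
  have "real (b G) \<ge> 1" using irr by (simp add: is_irrep_def Suc_le_eq)
  then show ?thesis using excess_bounds[OF _ _ bound(1) assms(14)] bound(2) by simp
qed

end
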